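(* Let $G$ be a finite simple graph, let $G_1,G_2$ be subgraphs with $V(G)=V(G_1)\cup V(G_2)$ and $E(G)=E(G_1)\cup E(G_2)$, and let $H$ be the graph with $V(H)=V(G_1)\cap V(G_2)$, $E(H)=E(G_1)\cap E(G_2)$. Let $t$ be a rational number. If $\chi_f(G_1)\le t$ and every extremal fractional coloring in $\mathcal{F}_t(H)$ is extensible in $\mathcal{F}_t(G_2)$, then $\chi_f(G)\le t$.
   Context: A $b$-fold coloring $\mathbf{c}$ of a graph assigns to each vertex a set of $b$ colors so that adjacent vertices receive disjoint sets; $A(\mathbf{c})$ is the set of colors used. Two $b$-fold colorings are isomorphic if they differ by a bijective renaming of colors. $\mathbf{c}_1+\mathbf{c}_2$ assigns each vertex the disjoint union of its color sets, and $t\cdot\mathbf{c}$ is the sum of $t$ copies. For $\mathbf{c}_1$ $b_1$-fold and $\mathbf{c}_2$ $b_2$-fold, $\mathbf{c}_1\sim\mathbf{c}_2$ if $sb_2\cdot\mathbf{c}_1$ and $sb_1\cdot\mathbf{c}_2$ are isomorphic for some positive integer $s$. $\mathcal{F}(G)$ is the set of $\sim$-classes of multifold colorings of $G$ (fractional colorings); the class of a $b$-fold $\mathbf{c}$ is $\frac{\mathbf{c}}{b}$. For rational $\lambda=q/p\in[0,1]$, $\lambda\frac{\mathbf{c}_1}{b_1}+(1-\lambda)\frac{\mathbf{c}_2}{b_2}=\frac{qb_2\cdot\mathbf{c}_1+(p-q)b_1\cdot\mathbf{c}_2}{pb_1b_2}$. Let $g_G(\frac{\mathbf{c}}{b})=|A(\mathbf{c})|/b$,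 $\mathcal{F}_t(G)=\{f\in\mathcal{F}(G):g_G(f)\le t\}$; a member of $\mathcal{F}_t(G)$ is extremal if it cannot be written as a linear combination of two or more distinct members of $\mathcal{F}_t(G)$. The fractional chromatic number is $\chi_f(G)=\min\{g_G(f):f\in\mathcal{F}(G)\}$. For a subgraph $H$ of $G$, restriction induces $i_G^H\colon\mathcal{F}(G)\to\mathcal{F}(H)$, and $f\in\mathcal{F}(H)$ is extensible in $\mathcal{F}_t(G)$ if $f=i_G^H(f')$ for some $f'\in\mathcal{F}_t(G)$. *)

theory Defs
  imports
    Complex_Main
    "HOL-Library.Nat_Bijection"
    "Graph_Theory.Digraph_Component"
    "Graph_Theory.Pair_Digraph"
begin

text \<open>
  A finite simple graph is a \<open>pair_graph\<close>: an edge \<open>uv\<close> is the pair of arcs \<open>(u, v)\<close>, \<open>(v, u)\<close>.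

  Colors are natural numbers. This is no restriction up to renaming of colors, since a coloring
  of a finite graph uses finitely many colors, and it makes the fractional colorings a set.
  The fold number \<open>b\<close> is carried along with the coloring, because on the graph without vertices
  it is not determined by the coloring. Colorings are \<open>{}\<close> outside the vertex set.
\<close>

definition multifold_colorings :: "'a pair_pre_digraph \<Rightarrow> (nat \<times> ('a \<Rightarrow> nat set)) set" where
  "multifold_colorings G = {(b, c). b > 0 \<and>
     (\<forall>v\<in>pverts G. finite (c v) \<and> card (c v) = b) \<and>
     (\<forall>v. v \<notin> pverts G \<longrightarrow> c v = {}) \<and>
     (\<forall>(u, v)\<in>parcs G. c u \<inter> c v = {})}"

definition used_colors :: "'a pair_pre_digraph \<Rightarrow> ('a \<Rightarrow> nat set) \<Rightarrow> nat set" where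
  "used_colors G c = (\<Union>v\<in>pverts G. c v)"

definition isomorphic_colorings ::
    "'a pair_pre_digraph \<Rightarrow> ('a \<Rightarrow> nat set) \<Rightarrow> ('a \<Rightarrow> nat set) \<Rightarrow> bool" where
  "isomorphic_colorings G c1 c2 \<longleftrightarrow>
     (\<exists>\<phi>. bij_betw \<phi> (used_colors G c1) (used_colors G c2) \<and> (\<forall>v\<in>pverts G. c2 v = \<phi> ` c1 v))"

text \<open>\<open>A <+> B\<close> is the disjoint union, and \<open>sum_encode\<close> is a bijection from \<open>nat + nat\<close> to \<open>nat\<close>.\<close>

definition coloring_sum :: "('a \<Rightarrow> nat set) \<Rightarrow> ('a \<Rightarrow> nat set) \<Rightarrow> 'a \<Rightarrow> nat set" where
  "coloring_sum c1 c2 = (\<lambda>v. sum_encode ` (c1 v <+> c2 v))"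

primrec coloring_mult :: "nat \<Rightarrow> ('a \<Rightarrow> nat set) \<Rightarrow> 'a \<Rightarrow> nat set" where
  "coloring_mult 0 c = (\<lambda>v. {})"
| "coloring_mult (Suc t) c = coloring_sum (coloring_mult t c) c"

definition frac_rel ::
    "'a pair_pre_digraph \<Rightarrow> ((nat \<times> ('a \<Rightarrow> nat set)) \<times> (nat \<times> ('a \<Rightarrow> nat set))) set" where
  "frac_rel G = {((b1, c1), (b2, c2)).
     (b1, c1) \<in> multifold_colorings G \<and> (b2, c2) \<in> multifold_colorings G \<and>
     (\<exists>s>0. isomorphic_colorings G (coloring_mult (s * b2) c1) (coloring_mult (s * b1) c2))}"

type_synonym 'a frac_coloring = "(nat \<times> ('a \<Rightarrow> nat set)) set"

definition frac_colorings :: "'a pair_pre_digraph \<Rightarrow> 'a frac_coloring set" where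
  "frac_colorings G = multifold_colorings G // frac_rel G"

text \<open>
  The functions below are lifted from representatives to classes: the union of the resulting
  classes, or the element of the set of resulting values, over all choices of representatives
  (which all give the same result).
\<close>

definition frac_combination ::
    "'a pair_pre_digraph \<Rightarrow> rat \<Rightarrow> 'a frac_coloring \<Rightarrow> 'a frac_coloring \<Rightarrow> 'a frac_coloring" where
  "frac_combination G l f1 f2 =
     (let (q, p) = map_prod nat nat (quotient_of l) in
      \<Union>(b1, c1)\<in>f1. \<Union>(b2, c2)\<in>f2. frac_rel G ``
        {(p * b1 * b2,
          coloring_sum (coloring_mult (q * b2) c1) (coloring_mult ((p - q) * b1) c2))})"

text \<open>
  \<open>l\<^sub>1 f\<^sub>1 + \<dots> + l\<^sub>n f\<^sub>n\<close> as an iterated binary combination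
  \<open>l\<^sub>1 f\<^sub>1 + (1 - l\<^sub>1) (l\<^sub>2 / (1 - l\<^sub>1) f\<^sub>2 + \<dots> + l\<^sub>n / (1 - l\<^sub>1) f\<^sub>n)\<close>,
  for positive \<open>l\<^sub>i\<close> with sum 1; in particular \<open>l = 1\<close> in the case of a singleton list.
\<close>

fun frac_lin_comb ::
    "'a pair_pre_digraph \<Rightarrow> (rat \<times> 'a frac_coloring) list \<Rightarrow> 'a frac_coloring" where
  "frac_lin_comb G [] = {}"
| "frac_lin_comb G [(l, f)] = f"
| "frac_lin_comb G ((l, f) # x # xs) =
     frac_combination G l f (frac_lin_comb G (map (\<lambda>(m, h). (m / (1 - l), h)) (x # xs)))"

definition color_ratio :: "'a pair_pre_digraph \<Rightarrow> 'a frac_coloring \<Rightarrow> rat" where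
  "color_ratio G f = the_elem ((\<lambda>(b, c). of_nat (card (used_colors G c)) / of_nat b) ` f)"

definition frac_colorings_le :: "'a pair_pre_digraph \<Rightarrow> rat \<Rightarrow> 'a frac_coloring set" where
  "frac_colorings_le G t = {f \<in> frac_colorings G. color_ratio G f \<le> t}"

text \<open>The coefficients are required to be positive: \<open>f = 1 f + 0 h\<close> does not count.\<close>

definition extremal :: "'a pair_pre_digraph \<Rightarrow> rat \<Rightarrow> 'a frac_coloring \<Rightarrow> bool" where
  "extremal G t f \<longleftrightarrow> f \<in> frac_colorings_le G t \<and>
     \<not> (\<exists>xs. length xs \<ge> 2 \<and> distinct (map snd xs) \<and> set (map snd xs) \<subseteq> frac_colorings_le G t \<and>
            (\<forall>l\<in>set (map fst xs). l > 0) \<and> sum_list (map fst xs) = 1 \<and>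
            f = frac_lin_comb G xs)"

text \<open>The set need not be finite, so its minimum is its \<open>Least\<close> element rather than \<open>Min\<close>.\<close>

definition frac_chromatic_number :: "'a pair_pre_digraph \<Rightarrow> rat" where
  "frac_chromatic_number G = (LEAST x. x \<in> color_ratio G ` frac_colorings G)"

definition frac_restrict :: "'a pair_pre_digraph \<Rightarrow> 'a frac_coloring \<Rightarrow> 'a frac_coloring" where
  "frac_restrict H f =
     (\<Union>(b, c)\<in>f. frac_rel H `` {(b, \<lambda>v. if v \<in> pverts H then c v else {})})"

definition extensible ::
    "'a pair_pre_digraph \<Rightarrow> 'a pair_pre_digraph \<Rightarrow> rat \<Rightarrow> 'a frac_coloring \<Rightarrow> bool" where
  "extensible H G t f \<longleftrightarrow> (\<exists>f'\<in>frac_colorings_le G t. f = frac_restrict H f')"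

end

theory Submission
  imports Defs
begin

text \<open>
  Up to \<open>\<sim>\<close>, a multifold coloring is determined by the rational weights
  \<open>w S = |{x. x is used exactly on S}| / b\<close> of the independent sets \<open>S\<close>. So \<open>\<F>\<^sub>t\<close> is
  the set of rational points of a polytope, convex combinations are the pointwise ones, and
  restriction is linear. Pushing a point that is not a vertex in two opposite directions until the
  support shrinks writes it as a convex combination of vertices; vertices are extremal. Hence if
  the extremal points of \<open>\<F>\<^sub>t(H)\<close> extend to \<open>G\<^sub>2\<close>, so do all its points, in particular the
  restriction of an optimal fractional coloring of \<open>G\<^sub>1\<close>. The two colorings agreeing on \<open>H\<close> are
  glued by a renaming that identifies as many colors as possible.
\<close>

section \<open>Weights of color classes\<close>

text \<open>A class of colorings has to become a single vector before convexity can be used. Class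
  counts divided by the fold number serve for this, because the scaling factors in the definition of
  \<sim> cancel in them. All numbers are rational, so compactness is not at hand. Vertices are
  therefore described by supports, and points are moved along a line until a coordinate vanishes,
  which needs only field operations and a minimum of finitely many ratios. The same device shows
  that the minimum in \<chi>_f exists: it is attained at one of finitely many vertices. Gluing needs
  no more colors than the larger of the two colorings has. A color of \<open>G1\<close> that misses
  \<open>H\<close> may be identified with any color of \<open>G2\<close> that misses
  \<open>H\<close>, since no edge of \<open>G\<close> joins a vertex outside \<open>G2\<close> to a
  vertex outside \<open>G1\<close>.\<close>

definition color_class :: "'a pair_pre_digraph \<Rightarrow> ('a \<Rightarrow> nat set) \<Rightarrow> nat \<Rightarrow> 'a set" where
  "color_class G c x = {v \<in> pverts G. x \<in> c v}"

definition class_size :: "'a pair_pre_digraph \<Rightarrow> ('a \<Rightarrow> nat set) \<Rightarrow> 'a set \<Rightarrow> nat" where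
  "class_size G c S = card {x \<in> used_colors G c. color_class G c x = S}"

definition class_weight ::
    "'a pair_pre_digraph \<Rightarrow> nat \<times> ('a \<Rightarrow> nat set) \<Rightarrow> 'a set \<Rightarrow> rat" where
  "class_weight G = (\<lambda>(b, c) S. of_nat (class_size G c S) / of_nat b)"

definition total_weight :: "'a pair_pre_digraph \<Rightarrow> ('a set \<Rightarrow> rat) \<Rightarrow> rat" where
  "total_weight G w = (\<Sum>S\<in>Pow (pverts G). w S)"

definition weightings :: "'a pair_pre_digraph \<Rightarrow> ('a set \<Rightarrow> rat) set" where
  "weightings G = {w. (\<forall>S. 0 \<le> w S) \<and>
     (\<forall>S. w S \<noteq> 0 \<longrightarrow> S \<subseteq> pverts G \<and> S \<noteq> {} \<and> (\<forall>u\<in>S. \<forall>v\<in>S. (u, v) \<notin> parcs G)) \<and>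
     (\<forall>v\<in>pverts G. (\<Sum>S | S \<in> Pow (pverts G) \<and> v \<in> S. w S) = 1)}"

text \<open>Unlike in \<open>multifold_colorings\<close>, the fold number 0 is allowed, as for \<open>coloring_mult 0 c\<close>.\<close>

definition fold_coloring :: "'a pair_pre_digraph \<Rightarrow> nat \<Rightarrow> ('a \<Rightarrow> nat set) \<Rightarrow> bool" where
  "fold_coloring G b c \<longleftrightarrow>
     (\<forall>v\<in>pverts G. finite (c v) \<and> card (c v) = b) \<and>
     (\<forall>v. v \<notin> pverts G \<longrightarrow> c v = {}) \<and>
     (\<forall>(u, v)\<in>parcs G. c u \<inter> c v = {})"

lemma multifold_colorings_iff: "(b, c) \<in> multifold_colorings G \<longleftrightarrow> b > 0 \<and> fold_coloring G b c"
  by (auto simp: multifold_colorings_def fold_coloring_def)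

lemma fold_coloring_finite: "fold_coloring G b c \<Longrightarrow> finite (c v)"
  unfolding fold_coloring_def by (metis finite.emptyI)

lemma finite_used_colors:
  assumes "finite (pverts G)" and "fold_coloring G b c"
  shows "finite (used_colors G c)"
  using assms(1) fold_coloring_finite[OF assms(2)] by (simp add: used_colors_def)

lemma coloring_sum_simps:
  "sum_encode (Inl x) \<in> coloring_sum c1 c2 v \<longleftrightarrow> x \<in> c1 v"
  "sum_encode (Inr y) \<in> coloring_sum c1 c2 v \<longleftrightarrow> y \<in> c2 v"
  by (auto simp: coloring_sum_def inj_image_mem_iff[OF inj_sum_encode])

lemma color_class_sum:
  "color_class G (coloring_sum c1 c2) (sum_encode (Inl x)) = color_class G c1 x"
  "color_class G (coloring_sum c1 c2) (sum_encode (Inr y)) = color_class G c2 y"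
  by (auto simp: color_class_def coloring_sum_simps)

lemma used_colors_iff: "x \<in> used_colors G c \<longleftrightarrow> color_class G c x \<noteq> {}"
  by (auto simp: used_colors_def color_class_def)

text \<open>A color of the sum comes from exactly one summand and keeps its class there.\<close>

lemma class_size_sum:
  assumes "finite (used_colors G c1)" and "finite (used_colors G c2)"
  shows "class_size G (coloring_sum c1 c2) S = class_size G c1 S + class_size G c2 S"
proof -
  let ?A = "\<lambda>c. {x \<in> used_colors G c. color_class G c x = S}"
  have "?A (coloring_sum c1 c2) = sum_encode ` (?A c1 <+> ?A c2)"
  proof (intro set_eqI iffI)
    fix y assume y: "y \<in> ?A (coloring_sum c1 c2)"
    obtain z where z: "y = sum_encode z" by (metis sum_decode_inverse)
    show "y \<in> sum_encode ` (?A c1 <+> ?A c2)"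
      using y z by (cases z) (auto simp: used_colors_iff color_class_sum)
  qed (auto simp: used_colors_iff color_class_sum)
  then have "class_size G (coloring_sum c1 c2) S = card (?A c1 <+> ?A c2)"
    unfolding class_size_def by (simp add: card_image[OF inj_sum_encode])
  then show ?thesis
    using assms by (simp add: class_size_def card_Plus)
qed

lemma fold_coloring_sum:
  assumes "fold_coloring G b1 c1" and "fold_coloring G b2 c2"
  shows "fold_coloring G (b1 + b2) (coloring_sum c1 c2)"
proof -
  have "card (coloring_sum c1 c2 v) = card (c1 v) + card (c2 v)" for v
    using assms[THEN fold_coloring_finite, of v] unfolding coloring_sum_def
    by (simp add: card_image[OF inj_sum_encode] card_Plus)
  moreover have "finite (coloring_sum c1 c2 v)" for v
    using assms[THEN fold_coloring_finite, of v] by (simp add: coloring_sum_def)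
  moreover have "coloring_sum c1 c2 u \<inter> coloring_sum c1 c2 v = {}"
    if "c1 u \<inter> c1 v = {}" "c2 u \<inter> c2 v = {}" for u v
    using that unfolding coloring_sum_def
    by (subst image_Int[OF inj_sum_encode, symmetric]) auto
  moreover have "coloring_sum c1 c2 v = {}" if "c1 v = {}" "c2 v = {}" for v
    using that by (simp add: coloring_sum_def)
  ultimately show ?thesis
    using assms unfolding fold_coloring_def by (simp add: case_prod_beta)
qed

lemma fold_coloring_mult:
  "fold_coloring G b c \<Longrightarrow> fold_coloring G (s * b) (coloring_mult s c)"
proof (induction s)
  case (Suc s)
  then show ?case
    using fold_coloring_sum[of G "s * b" "coloring_mult s c" b c] by (simp add: add.commute)
qed (auto simp: fold_coloring_def)

lemma class_size_mult:
  assumes "finite (pverts G)" and "fold_coloring G b c"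
  shows "class_size G (coloring_mult s c) S = s * class_size G c S"
proof (induction s)
  case 0
  then show ?case by (simp add: class_size_def used_colors_def)
next
  case (Suc s)
  then show ?case
    using class_size_sum[of G "coloring_mult s c" c]
      finite_used_colors[OF assms(1)] fold_coloring_mult[OF assms(2), of s] assms(2)
    by (auto simp: add.commute)
qed

text \<open>Colors are sorted by their class. The instances of \<open>P\<close> that matter are:
  always true (all colors), containing \<open>v\<close> (the colors at \<open>v\<close>), and having
  a given trace on a subgraph (restriction).\<close>

lemma card_colors_eq_sum:
  assumes "finite (pverts G)" and "finite (used_colors G c)"
  shows "card {x \<in> used_colors G c. P (color_class G c x)} =
         (\<Sum>S | S \<in> Pow (pverts G) \<and> P S. class_size G c S)"
proof -
  have "{x \<in> used_colors G c. P (color_class G c x)} =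
      (\<Union>S\<in>{S \<in> Pow (pverts G). P S}. {x \<in> used_colors G c. color_class G c x = S})"
    by (auto simp: color_class_def)
  also have "card \<dots> = (\<Sum>S | S \<in> Pow (pverts G) \<and> P S. class_size G c S)"
    unfolding class_size_def using assms by (subst card_UN_disjoint) auto
  finally show ?thesis .
qed

lemma total_class_weight:
  assumes "finite (pverts G)" and "(b, c) \<in> multifold_colorings G"
  shows "total_weight G (class_weight G (b, c)) = of_nat (card (used_colors G c)) / of_nat b"
proof -
  have "card (used_colors G c) = (\<Sum>S\<in>Pow (pverts G). class_size G c S)"
    using card_colors_eq_sum[OF assms(1), of c "\<lambda>_. True"] finite_used_colors[OF assms(1), of b c]
      assms(2) by (simp add: multifold_colorings_iff Pow_def)
  then show ?thesis
    by (simp add: total_weight_def class_weight_def sum_divide_distrib)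
qed

lemma class_weight_in_weightings:
  assumes fin: "finite (pverts G)" and x: "x \<in> multifold_colorings G"
  shows "class_weight G x \<in> weightings G"
proof -
  obtain b c where bc: "x = (b, c)" "b > 0" "fold_coloring G b c"
    using x by (cases x) (auto simp: multifold_colorings_iff)
  have "S \<subseteq> pverts G \<and> S \<noteq> {} \<and> (\<forall>u\<in>S. \<forall>v\<in>S. (u, v) \<notin> parcs G)"
    if S: "class_weight G x S \<noteq> 0" for S
  proof -
    from S have "class_size G c S \<noteq> 0" by (auto simp: class_weight_def bc)
    then obtain y where "y \<in> used_colors G c" "color_class G c y = S"
      unfolding class_size_def by (metis (mono_tags, lifting) card_eq_0_iff empty_Collect_eq)
    then show ?thesis
      using bc(3) by (fastforce simp: used_colors_iff color_class_def fold_coloring_def)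
  qed
  moreover have "(\<Sum>S | S \<in> Pow (pverts G) \<and> v \<in> S. class_weight G x S) = 1"
    if v: "v \<in> pverts G" for v
  proof -
    have "{y \<in> used_colors G c. v \<in> color_class G c y} = c v"
      using v by (auto simp: used_colors_def color_class_def)
    then have "(\<Sum>S | S \<in> Pow (pverts G) \<and> v \<in> S. class_size G c S) = b"
      using card_colors_eq_sum[OF fin finite_used_colors[OF fin bc(3)], of "\<lambda>S. v \<in> S"] bc(3) v
      by (simp add: fold_coloring_def)
    then show ?thesis
      using bc(2) by (simp add: class_weight_def bc(1) flip: sum_divide_distrib of_nat_sum)
  qed
  ultimately show ?thesis
    by (auto simp: weightings_def class_weight_def bc(1))
qed

section \<open>Realizing weightings by colorings\<close>

text \<open>The denominators are multiplied one after another. Nonnegativity makes the cleared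
  values natural numbers, which can then count colors.\<close>

lemma common_denominator:
  fixes w :: "'b \<Rightarrow> rat"
  assumes "finite A" and "\<And>a. a \<in> A \<Longrightarrow> 0 \<le> w a"
  shows "\<exists>b>0. \<forall>a\<in>A. \<exists>n. of_nat n = of_nat b * w a"
  using assms
proof (induction A rule: finite_induct)
  case (insert a A)
  then obtain b where b: "b > 0" "\<forall>a\<in>A. \<exists>n. of_nat n = of_nat b * w a" by auto
  obtain p q where pq: "quotient_of (w a) = (p, q)" by force
  have w: "w a = of_int p / of_int q" "q > 0"
    using pq quotient_of_div quotient_of_denom_pos by auto
  then have "p \<ge> 0" using insert.prems[of a] by (auto simp: zero_le_divide_iff)
  have "of_nat (b * nat p) = of_nat (b * nat q) * w a"
    using w \<open>p \<ge> 0\<close> by simp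
  moreover have "\<exists>n. of_nat n = of_nat (b * nat q) * w a'" if a': "a' \<in> A" for a'
  proof -
    obtain n where "of_nat n = of_nat b * w a'" using b a' by blast
    then have "of_nat (n * nat q) = of_nat (b * nat q) * w a'" by simp
    then show ?thesis by blast
  qed
  ultimately show ?case
    using b(1) w(2) by (intro exI[of _ "b * nat q"]) (auto simp del: of_nat_mult)
qed auto

text \<open>After clearing denominators by \<open>b\<close>, each set \<open>S\<close> receives
  \<open>b * w S\<close> colors of its own, used on exactly the vertices of \<open>S\<close>. The
  equation of the weighting at \<open>v\<close> then says that \<open>v\<close> has \<open>b\<close>
  colors.\<close>

lemma weighting_realizable:
  assumes fin: "finite (pverts G)" and w: "w \<in> weightings G"
  obtains x where "x \<in> multifold_colorings G" and "class_weight G x = w"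
proof -
  obtain b where b: "b > 0" "\<forall>S\<in>Pow (pverts G). \<exists>n. of_nat n = of_nat b * w S"
    using common_denominator[of "Pow (pverts G)" w] fin w by (auto simp: weightings_def)
  then obtain n :: "'a set \<Rightarrow> nat"
    where n: "\<And>S. S \<in> Pow (pverts G) \<Longrightarrow> of_nat (n S) = of_nat b * w S" by metis
  \<comment> \<open>The abstract colors: \<open>(S, i)\<close> is the \<open>i\<close>-th color with
    class \<open>S\<close>. The injection \<open>e\<close> turns them into natural numbers.\<close>
  define K where "K = Sigma (Pow (pverts G)) (\<lambda>S. {..<n S})"
  have "finite K" using fin by (auto simp: K_def)
  from finite_imp_inj_to_nat_seg[OF this]
  obtain e :: "'a set \<times> nat \<Rightarrow> nat" where e: "inj_on e K" by auto
  define c where "c v = e ` {k \<in> K. v \<in> fst k}" for v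
  have n_zero: "S \<noteq> {} \<and> (\<forall>u\<in>S. \<forall>v\<in>S. (u, v) \<notin> parcs G)" if "(S, i) \<in> K" for S i
  proof -
    have "n S > 0" "S \<in> Pow (pverts G)" using that by (auto simp: K_def)
    then have "w S \<noteq> 0" using n[of S] by auto
    then show ?thesis using w by (auto simp: weightings_def)
  qed
  have ec: "e k \<in> c v \<longleftrightarrow> v \<in> fst k" if "k \<in> K" for k v
    using that e by (auto simp: c_def inj_on_def)
  have cls: "color_class G c (e k) = fst k" if "k \<in> K" for k
    using that by (auto simp: color_class_def ec K_def)
  have used: "used_colors G c = e ` K"
  proof
    show "used_colors G c \<subseteq> e ` K" by (auto simp: used_colors_def c_def)
    show "e ` K \<subseteq> used_colors G c"
      using n_zero cls by (fastforce simp: used_colors_iff)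
  qed
  have size: "class_size G c S = n S" if "S \<in> Pow (pverts G)" for S
  proof -
    have "{x \<in> used_colors G c. color_class G c x = S} = e ` ({S} \<times> {..<n S})"
    proof -
      have "{x \<in> used_colors G c. color_class G c x = S} = e ` {k \<in> K. fst k = S}"
        using cls by (auto simp: used)
      also have "{k \<in> K. fst k = S} = {S} \<times> {..<n S}"
        using that by (auto simp: K_def)
      finally show ?thesis .
    qed
    moreover have "inj_on e ({S} \<times> {..<n S})"
      using that by (intro inj_on_subset[OF e]) (auto simp: K_def)
    ultimately show ?thesis by (simp add: class_size_def card_image)
  qed
  have card_c: "card (c v) = b" if v: "v \<in> pverts G" for v
  proof -
    have "{y \<in> used_colors G c. v \<in> color_class G c y} = c v"
      using v by (auto simp: used_colors_def color_class_def)
    then have "card (c v) = (\<Sum>S | S \<in> Pow (pverts G) \<and> v \<in> S. class_size G c S)"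
      using card_colors_eq_sum[OF fin, of c "\<lambda>S. v \<in> S"] used \<open>finite K\<close> by simp
    then have "of_nat (card (c v)) = (\<Sum>S | S \<in> Pow (pverts G) \<and> v \<in> S. of_nat b * w S)"
      by (simp add: size n)
    also have "\<dots> = of_nat b"
      using w v by (simp add: weightings_def flip: sum_distrib_left)
    finally show ?thesis by simp
  qed
  have "fold_coloring G b c"
    unfolding fold_coloring_def
  proof (intro conjI ballI allI impI)
    fix v show "finite (c v)" using \<open>finite K\<close> by (simp add: c_def)
  next
    fix a assume a: "a \<in> parcs G"
    obtain u v where uv: "a = (u, v)" by force
    have "y \<notin> c v" if "y \<in> c u" for y
    proof -
      from that obtain k where "k \<in> K" "y = e k" "u \<in> fst k" unfolding c_def by blast
      then show ?thesis using ec[of k v] n_zero[of "fst k" "snd k"] a uv by auto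
    qed
    then show "case a of (u, v) \<Rightarrow> c u \<inter> c v = {}" using uv by auto
  next
    show "c v = {}" if "v \<notin> pverts G" for v
      using that by (auto simp: c_def K_def)
  qed (rule card_c)
  then have mem: "(b, c) \<in> multifold_colorings G" using b(1) by (simp add: multifold_colorings_iff)
  have "class_weight G (b, c) S = w S" for S
  proof (cases "S \<in> Pow (pverts G)")
    case True
    then show ?thesis using b(1) by (simp add: class_weight_def size n)
  next
    case False
    then show ?thesis
      using w class_weight_in_weightings[OF fin mem] unfolding weightings_def mem_Collect_eq
      by (metis PowI)
  qed
  then show ?thesis using that[OF mem] by blast
qed

section \<open>Isomorphism and equivalence of colorings\<close>

text \<open>Injections chosen fiber by fiber fit together because distinct fibers of
  \<open>f\<close> go to distinct fibers of \<open>g\<close>. With classes as fibers this produces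
  isomorphisms; with traces of classes on \<open>H\<close> it produces the renaming used for
  gluing.\<close>

lemma fiberwise_injection:
  assumes "finite A" and "finite B"
    and le: "\<And>s. card {x \<in> A. f x = s} \<le> card {y \<in> B. g y = s}"
  obtains \<phi> where "inj_on \<phi> A" and "\<phi> ` A \<subseteq> B" and "\<And>x. x \<in> A \<Longrightarrow> g (\<phi> x) = f x"
proof -
  have "\<forall>s. \<exists>\<phi>. \<phi> ` {x \<in> A. f x = s} \<subseteq> {y \<in> B. g y = s} \<and> inj_on \<phi> {x \<in> A. f x = s}"
    using assms by (intro allI card_le_inj) auto
  from choice[OF this] obtain \<phi> where \<phi>: "\<And>s. \<phi> s ` {x \<in> A. f x = s} \<subseteq> {y \<in> B. g y = s}"
    "\<And>s. inj_on (\<phi> s) {x \<in> A. f x = s}" by blast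
  have g: "g (\<phi> (f x) x) = f x" "\<phi> (f x) x \<in> B" if "x \<in> A" for x
    using \<phi>(1)[of "f x"] that by auto
  have "inj_on (\<lambda>x. \<phi> (f x) x) A"
  proof (rule inj_onI)
    fix x y assume xy: "x \<in> A" "y \<in> A" "\<phi> (f x) x = \<phi> (f y) y"
    then have "f x = f y" using g(1) by metis
    then show "x = y" using inj_onD[OF \<phi>(2)[of "f y"], of x y] xy by simp
  qed
  then show ?thesis using that[of "\<lambda>x. \<phi> (f x) x"] g by blast
qed

lemma isomorphic_colorings_iff:
  assumes fin: "finite (used_colors G c1)" "finite (used_colors G c2)"
  shows "isomorphic_colorings G c1 c2 \<longleftrightarrow> class_size G c1 = class_size G c2"
proof
  assume "isomorphic_colorings G c1 c2"
  then obtain \<phi> where \<phi>: "bij_betw \<phi> (used_colors G c1) (used_colors G c2)"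
    and c2: "\<forall>v\<in>pverts G. c2 v = \<phi> ` c1 v" by (auto simp: isomorphic_colorings_def)
  have "\<phi> x \<in> c2 v \<longleftrightarrow> x \<in> c1 v" if "x \<in> used_colors G c1" "v \<in> pverts G" for x v
  proof -
    have "c1 v \<subseteq> used_colors G c1" using that by (auto simp: used_colors_def)
    then show ?thesis
      using that c2 bij_betw_imp_inj_on[OF \<phi>] by (auto simp: inj_on_image_mem_iff)
  qed
  then have cls: "color_class G c2 (\<phi> x) = color_class G c1 x" if "x \<in> used_colors G c1" for x
    using that by (auto simp: color_class_def)
  have "class_size G c1 S = class_size G c2 S" for S
  proof -
    have "\<phi> ` {x \<in> used_colors G c1. color_class G c1 x = S} =
        {x \<in> used_colors G c2. color_class G c2 x = S}"
      using cls by (auto simp flip: bij_betw_imp_surj_on[OF \<phi>])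
    moreover have "inj_on \<phi> {x \<in> used_colors G c1. color_class G c1 x = S}"
      using bij_betw_imp_inj_on[OF \<phi>] by (rule inj_on_subset) auto
    ultimately show ?thesis
      using card_image[of \<phi> "{x \<in> used_colors G c1. color_class G c1 x = S}"]
      by (simp add: class_size_def)
  qed
  then show "class_size G c1 = class_size G c2" by auto
next
  assume eq: "class_size G c1 = class_size G c2"
  have size: "card {x \<in> used_colors G c1. color_class G c1 x = S} =
      card {y \<in> used_colors G c2. color_class G c2 y = S}" for S
    using fun_cong[OF eq, of S] by (simp add: class_size_def)
  obtain \<phi> where \<phi>: "inj_on \<phi> (used_colors G c1)" "\<phi> ` used_colors G c1 \<subseteq> used_colors G c2"
      "\<And>x. x \<in> used_colors G c1 \<Longrightarrow> color_class G c2 (\<phi> x) = color_class G c1 x"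
    by (rule fiberwise_injection[OF fin eq_refl[OF size]]) (rule that)
  \<comment> \<open>The injection backwards only serves to compare cardinalities, which makes
    \<open>\<phi>\<close> surjective.\<close>
  obtain \<psi> where \<psi>: "inj_on \<psi> (used_colors G c2)" "\<psi> ` used_colors G c2 \<subseteq> used_colors G c1"
    by (rule fiberwise_injection[OF fin(2,1) eq_refl[OF size[symmetric]]]) (rule that)
  have "card (used_colors G c2) \<le> card (\<phi> ` used_colors G c1)"
    using card_inj_on_le[OF \<psi> fin(1)] \<phi>(1) by (simp add: card_image)
  then have bij: "\<phi> ` used_colors G c1 = used_colors G c2"
    using card_seteq[OF fin(2) \<phi>(2)] by simp
  have "c2 v = \<phi> ` c1 v" if v: "v \<in> pverts G" for v
  proof
    show "\<phi> ` c1 v \<subseteq> c2 v"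
      using v \<phi>(3) by (auto simp: color_class_def used_colors_def)
    show "c2 v \<subseteq> \<phi> ` c1 v"
    proof
      fix y assume y: "y \<in> c2 v"
      then have "y \<in> used_colors G c2" using v by (auto simp: used_colors_def)
      then obtain x where "x \<in> used_colors G c1" "y = \<phi> x" using bij by blast
      then show "y \<in> \<phi> ` c1 v" using \<phi>(3)[of x] y v by (auto simp: color_class_def)
    qed
  qed
  then show "isomorphic_colorings G c1 c2"
    using \<phi>(1) bij unfolding isomorphic_colorings_def bij_betw_def by blast
qed

text \<open>The two multiples have class sizes \<open>s * b2 * class_size G c1 S\<close> and
  \<open>s * b1 * class_size G c2 S\<close>. Cancelling \<open>s\<close> leaves the cross-multiplied
  equality of the weights, so every positive \<open>s\<close> gives the same condition.\<close>

lemma frac_rel_iff: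
  assumes fin: "finite (pverts G)"
  shows "(x, y) \<in> frac_rel G \<longleftrightarrow> x \<in> multifold_colorings G \<and> y \<in> multifold_colorings G \<and>
    class_weight G x = class_weight G y"
proof -
  obtain b1 c1 b2 c2 where xy: "x = (b1, c1)" "y = (b2, c2)" by (cases x, cases y)
  have "(\<exists>s>0. isomorphic_colorings G (coloring_mult (s * b2) c1) (coloring_mult (s * b1) c2)) \<longleftrightarrow>
      class_weight G x = class_weight G y"
    if b: "b1 > 0" "b2 > 0" and c: "fold_coloring G b1 c1" "fold_coloring G b2 c2"
  proof -
    have "isomorphic_colorings G (coloring_mult (s * b2) c1) (coloring_mult (s * b1) c2) \<longleftrightarrow>
        class_weight G x = class_weight G y" if "s > 0" for s
    proof -
      have "class_weight G x S = class_weight G y S \<longleftrightarrow>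
          b2 * class_size G c1 S = b1 * class_size G c2 S" for S
        using b by (simp add: class_weight_def xy frac_eq_eq mult.commute flip: of_nat_mult)
      moreover have "isomorphic_colorings G (coloring_mult (s * b2) c1) (coloring_mult (s * b1) c2) \<longleftrightarrow>
          (\<forall>S. s * b2 * class_size G c1 S = s * b1 * class_size G c2 S)"
        using fold_coloring_mult c finite_used_colors[OF fin]
        by (subst isomorphic_colorings_iff) (blast, blast, auto simp: fun_eq_iff class_size_mult[OF fin])
      ultimately show ?thesis using that by (auto simp: fun_eq_iff)
    qed
    then show ?thesis by blast
  qed
  then show ?thesis by (auto simp: frac_rel_def xy multifold_colorings_iff)
qed

section \<open>Fractional colorings as weightings\<close>

definition weighting_of :: "'a pair_pre_digraph \<Rightarrow> 'a frac_coloring \<Rightarrow> 'a set \<Rightarrow> rat" where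
  "weighting_of G f = class_weight G (SOME x. x \<in> f)"

lemma equiv_frac_rel:
  assumes "finite (pverts G)"
  shows "equiv (multifold_colorings G) (frac_rel G)"
proof (rule equivI)
  show "frac_rel G \<subseteq> multifold_colorings G \<times> multifold_colorings G"
    using frac_rel_iff[OF assms] by auto
  show "refl_on (multifold_colorings G) (frac_rel G)"
    by (rule refl_onI) (simp add: frac_rel_iff[OF assms])
  show "sym (frac_rel G)"
    by (rule symI) (simp add: frac_rel_iff[OF assms])
  show "trans (frac_rel G)"
    by (rule transI) (simp add: frac_rel_iff[OF assms])
qed

lemma frac_rel_class:
  assumes "finite (pverts G)" and "x \<in> multifold_colorings G"
  shows "frac_rel G `` {x} = {y \<in> multifold_colorings G. class_weight G y = class_weight G x}"
  using assms(2) by (intro set_eqI) (auto simp: Image_singleton_iff frac_rel_iff[OF assms(1)])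

lemma weighting_of_rep:
  assumes fin: "finite (pverts G)" and f: "f \<in> frac_colorings G" and x: "x \<in> f"
  shows "x \<in> multifold_colorings G" and "class_weight G x = weighting_of G f"
proof -
  obtain y where y: "y \<in> multifold_colorings G" "f = frac_rel G `` {y}"
    using f unfolding frac_colorings_def by (rule quotientE)
  then have feq: "f = {z \<in> multifold_colorings G. class_weight G z = class_weight G y}"
    using frac_rel_class[OF fin] by simp
  have "(SOME z. z \<in> f) \<in> f" using x by (rule someI)
  then show "x \<in> multifold_colorings G" "class_weight G x = weighting_of G f"
    using feq x by (auto simp: weighting_of_def)
qed

lemma frac_coloring_nonempty:
  assumes "finite (pverts G)" and "f \<in> frac_colorings G"
  obtains x where "x \<in> f"
  using assms(2) in_quotient_imp_non_empty[OF equiv_frac_rel[OF assms(1)]]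
  unfolding frac_colorings_def by blast

lemma weighting_of_in_weightings:
  assumes "finite (pverts G)" and "f \<in> frac_colorings G"
  shows "weighting_of G f \<in> weightings G"
proof -
  obtain x where x: "x \<in> f" using frac_coloring_nonempty[OF assms] .
  show ?thesis
    using class_weight_in_weightings[OF assms(1) weighting_of_rep(1)[OF assms x]]
      weighting_of_rep(2)[OF assms x] by simp
qed

lemma frac_coloring_eq:
  assumes fin: "finite (pverts G)" and f: "f \<in> frac_colorings G"
  shows "f = {x \<in> multifold_colorings G. class_weight G x = weighting_of G f}"
proof -
  obtain y where y: "y \<in> multifold_colorings G" "f = frac_rel G `` {y}"
    using f unfolding frac_colorings_def by (rule quotientE)
  have "y \<in> f" using y frac_rel_class[OF fin] by simp
  then show ?thesis
    using y(2) unfolding frac_rel_class[OF fin y(1)] weighting_of_rep(2)[OF fin f \<open>y \<in> f\<close>] by blast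
qed

lemma weighting_of_inject:
  assumes "finite (pverts G)" and "f \<in> frac_colorings G" and "h \<in> frac_colorings G"
    and "weighting_of G f = weighting_of G h"
  shows "f = h"
proof -
  have "f = {x \<in> multifold_colorings G. class_weight G x = weighting_of G h}"
    using frac_coloring_eq[OF assms(1,2)] unfolding assms(4) .
  also have "\<dots> = h"
    by (rule frac_coloring_eq[OF assms(1,3), symmetric])
  finally show ?thesis .
qed

text \<open>The lifted operations are unions of classes over all choices of representatives. When
  all results have the same weights, these classes coincide and the union is a single class; this is
  well-definedness.\<close>

lemma weighting_of_UN:
  assumes fin: "finite (pverts G)" and A: "A \<noteq> {}"
    and h: "\<And>a. a \<in> A \<Longrightarrow> h a \<in> multifold_colorings G"
      "\<And>a. a \<in> A \<Longrightarrow> class_weight G (h a) = w"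
  shows "(\<Union>a\<in>A. frac_rel G `` {h a}) \<in> frac_colorings G"
    and "weighting_of G (\<Union>a\<in>A. frac_rel G `` {h a}) = w"
proof -
  obtain a where a: "a \<in> A" using A by blast
  have eq: "(\<Union>a\<in>A. frac_rel G `` {h a}) = frac_rel G `` {h a}"
    using a frac_rel_class[OF fin h(1)] h(2) by auto
  show mem: "(\<Union>a\<in>A. frac_rel G `` {h a}) \<in> frac_colorings G"
    unfolding eq frac_colorings_def using h(1)[OF a] by (rule quotientI)
  have "h a \<in> (\<Union>a\<in>A. frac_rel G `` {h a})"
    using eq frac_rel_class[OF fin h(1)[OF a]] h(1)[OF a] by simp
  then show "weighting_of G (\<Union>a\<in>A. frac_rel G `` {h a}) = w"
    using weighting_of_rep(2)[OF fin mem] h(2)[OF a] by metis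
qed

lemma weighting_of_surj:
  assumes "finite (pverts G)" and "w \<in> weightings G"
  obtains f where "f \<in> frac_colorings G" and "weighting_of G f = w"
proof -
  obtain x where x: "x \<in> multifold_colorings G" "class_weight G x = w"
    using weighting_realizable[OF assms] .
  show ?thesis
    using weighting_of_UN[OF assms(1), of "{x}" "\<lambda>x. x" w] x that by simp
qed

lemma color_ratio_eq:
  assumes fin: "finite (pverts G)" and f: "f \<in> frac_colorings G"
  shows "color_ratio G f = total_weight G (weighting_of G f)"
proof -
  have ratio: "(case x of (b, c) \<Rightarrow> of_nat (card (used_colors G c)) / of_nat b) =
      total_weight G (weighting_of G f)" if "x \<in> f" for x
    using weighting_of_rep[OF fin f that] total_class_weight[OF fin, of "fst x" "snd x"]
    by (simp add: case_prod_beta)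
  obtain x where "x \<in> f" using frac_coloring_nonempty[OF fin f] .
  then have "(\<lambda>(b, c). of_nat (card (used_colors G c)) / of_nat b) ` f =
      {total_weight G (weighting_of G f)}"
    using ratio by (auto simp: image_iff)
  then show ?thesis by (simp add: color_ratio_def)
qed

definition weightings_le :: "'a pair_pre_digraph \<Rightarrow> rat \<Rightarrow> ('a set \<Rightarrow> rat) set" where
  "weightings_le G t = {w \<in> weightings G. total_weight G w \<le> t}"

lemma frac_colorings_le_iff:
  assumes "finite (pverts G)" and "f \<in> frac_colorings G"
  shows "f \<in> frac_colorings_le G t \<longleftrightarrow> weighting_of G f \<in> weightings_le G t"
  using assms color_ratio_eq[OF assms] weighting_of_in_weightings[OF assms]
  by (simp add: frac_colorings_le_def weightings_le_def)

section \<open>Convex combinations of fractional colorings\<close>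

lemma class_size_fold:
  assumes "(b, c) \<in> multifold_colorings G"
  shows "of_nat (class_size G c S) = of_nat b * class_weight G (b, c) S"
  using assms by (simp add: class_weight_def multifold_colorings_iff)

lemma frac_combination:
  assumes fin: "finite (pverts G)" and l: "0 \<le> l" "l \<le> 1"
    and f1: "f1 \<in> frac_colorings G" and f2: "f2 \<in> frac_colorings G"
  shows "frac_combination G l f1 f2 \<in> frac_colorings G" (is "?C \<in> _")
    and "weighting_of G (frac_combination G l f1 f2) =
      (\<lambda>S. l * weighting_of G f1 S + (1 - l) * weighting_of G f2 S)" (is "_ = ?w")
proof -
  obtain q' p' where qp': "quotient_of l = (q', p')" by force
  then have lq: "l = of_int q' / of_int p'" and p': "p' > 0"
    using quotient_of_div quotient_of_denom_pos by auto
  \<comment> \<open>For coefficients between 0 and 1, passing to \<open>nat\<close> loses nothing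
    and the natural subtraction \<open>p - q\<close> is a true difference.\<close>
  then have q': "0 \<le> q'" "q' \<le> p'"
    using l by (auto simp: zero_le_divide_iff)
  define q p where "q = nat q'" and "p = nat p'"
  have p: "p > 0" and q: "q \<le> p" and l': "l = of_nat q / of_nat p"
    using lq p' q' by (auto simp: q_def p_def)
  \<comment> \<open>The result for one pair of representatives; uncurried, the nested unions become
    one union over \<open>f1 \<times> f2\<close>.\<close>
  define h where "h = (\<lambda>((b1, c1), (b2, c2)). (p * b1 * b2,
      coloring_sum (coloring_mult (q * b2) c1) (coloring_mult ((p - q) * b1) c2)) ::
      nat \<times> ('a \<Rightarrow> nat set))"
  have C: "?C = (\<Union>a\<in>f1 \<times> f2. frac_rel G `` {h a})"
    by (auto simp: frac_combination_def qp' h_def q_def p_def)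
  have h: "h a \<in> multifold_colorings G \<and> class_weight G (h a) = ?w" if a: "a \<in> f1 \<times> f2" for a
  proof -
    obtain b1 c1 b2 c2 where a_eq: "a = ((b1, c1), (b2, c2))" by (metis surj_pair)
    have m1: "(b1, c1) \<in> multifold_colorings G" "class_weight G (b1, c1) = weighting_of G f1"
      using weighting_of_rep[OF fin f1, of "(b1, c1)"] a a_eq by auto
    have m2: "(b2, c2) \<in> multifold_colorings G" "class_weight G (b2, c2) = weighting_of G f2"
      using weighting_of_rep[OF fin f2, of "(b2, c2)"] a a_eq by auto
    have b: "b1 > 0" "b2 > 0" and c: "fold_coloring G b1 c1" "fold_coloring G b2 c2"
      using m1 m2 by (auto simp: multifold_colorings_iff)
    let ?d1 = "coloring_mult (q * b2) c1" and ?d2 = "coloring_mult ((p - q) * b1) c2"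
    have d: "fold_coloring G (q * b2 * b1) ?d1" "fold_coloring G ((p - q) * b1 * b2) ?d2"
      using fold_coloring_mult c by auto
    have "q * b2 * b1 + (p - q) * b1 * b2 = (q + (p - q)) * (b1 * b2)"
      by (simp only: distrib_left distrib_right mult_ac)
    also have "\<dots> = p * b1 * b2" using q by simp
    finally have "fold_coloring G (p * b1 * b2) (coloring_sum ?d1 ?d2)"
      using fold_coloring_sum[OF d] by simp
    then have mem: "h a \<in> multifold_colorings G"
      using b p by (simp add: h_def a_eq multifold_colorings_iff)
    have "class_weight G (h a) S = ?w S" for S
    proof -
      have "class_size G (coloring_sum ?d1 ?d2) S =
          q * b2 * class_size G c1 S + (p - q) * b1 * class_size G c2 S"
        using class_size_sum[OF finite_used_colors[OF fin d(1)] finite_used_colors[OF fin d(2)]]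
          class_size_mult[OF fin c(1)] class_size_mult[OF fin c(2)] by simp
      then have "of_nat (class_size G (coloring_sum ?d1 ?d2) S) =
          of_nat q * of_nat b2 * (of_nat b1 * weighting_of G f1 S) +
          (of_nat p - of_nat q) * of_nat b1 * (of_nat b2 * weighting_of G f2 S)"
        using class_size_fold[OF m1(1)] class_size_fold[OF m2(1)] m1(2) m2(2) q
        by (simp add: of_nat_diff)
      then show ?thesis
        using b p by (simp add: class_weight_def h_def a_eq l' divide_simps) (simp add: algebra_simps)
    qed
    then show ?thesis using mem by blast
  qed
  have ne: "f1 \<times> f2 \<noteq> {}"
    using frac_coloring_nonempty[OF fin f1] frac_coloring_nonempty[OF fin f2]
    by (metis SigmaI empty_iff)
  show "?C \<in> frac_colorings G"
    unfolding C using h by (intro weighting_of_UN(1)[OF fin ne, where w = ?w]) auto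
  show "weighting_of G ?C = ?w"
    unfolding C using h by (intro weighting_of_UN(2)[OF fin ne]) auto
qed

lemma sum_list_rescale:
  fixes a :: rat
  assumes "a \<noteq> 0"
  shows "a * (\<Sum>(m, h)\<leftarrow>map (\<lambda>(m, h). (m / a, h)) ys. m * g h) = (\<Sum>(m, h)\<leftarrow>ys. m * g h)"
  using assms by (induction ys) (auto simp: distrib_left)

text \<open>Positivity of all coefficients forces \<open>1 - l > 0\<close> as soon as a second entry
  exists, so the division in the recursion is legitimate. The rescaled tail again has sum 1, and the
  outer factor \<open>1 - l\<close> undoes the rescaling.\<close>

lemma frac_lin_comb:
  assumes "finite (pverts G)"
    and "set (map snd xs) \<subseteq> frac_colorings G" and "\<forall>l\<in>set (map fst xs). l > 0"
    and "sum_list (map fst xs) = 1"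
  shows "frac_lin_comb G xs \<in> frac_colorings G \<and>
    weighting_of G (frac_lin_comb G xs) = (\<lambda>S. \<Sum>(l, f)\<leftarrow>xs. l * weighting_of G f S)"
  using assms
proof (induction G xs rule: frac_lin_comb.induct)
  case (3 G l f x xs)
  have fin: "finite (pverts G)" using 3(2) .
  let ?ys = "x # xs" and ?zs = "map (\<lambda>(m, h). (m / (1 - l), h)) (x # xs)"
  have l: "l > 0" "sum_list (map fst ?ys) = 1 - l" using 3(4,5) by auto
  have "sum_list (map fst xs) \<ge> 0" using 3(4) by (intro sum_list_nonneg) auto
  then have l1: "1 - l > 0" using l 3(4) by auto
  have fst_zs: "map fst ?zs = map (\<lambda>m. m / (1 - l)) (map fst ?ys)"
    and snd_zs: "map snd ?zs = map snd ?ys" by (auto simp: case_prod_beta)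
  have "sum_list (map fst ?zs) = sum_list (map fst ?ys) / (1 - l)"
    unfolding fst_zs by (simp only: divide_inverse sum_list_mult_const map_map o_def flip: sum_list_mult_const)
  then have sum: "sum_list (map fst ?zs) = 1" using l l1 by simp
  have pos: "\<forall>m\<in>set (map fst ?zs). m > 0"
    unfolding fst_zs using 3(4) l1 by auto
  have cls: "set (map snd ?zs) \<subseteq> frac_colorings G"
    unfolding snd_zs using 3(3) by auto
  have IH: "frac_lin_comb G ?zs \<in> frac_colorings G"
    "weighting_of G (frac_lin_comb G ?zs) = (\<lambda>S. \<Sum>(m, h)\<leftarrow>?zs. m * weighting_of G h S)"
    using 3(1)[OF fin cls pos sum] by auto
  have "(1 - l) * (\<Sum>(m, h)\<leftarrow>?zs. m * weighting_of G h S) = (\<Sum>(m, h)\<leftarrow>?ys. m * weighting_of G h S)" for S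
    using l1 by (intro sum_list_rescale) simp
  moreover have "f \<in> frac_colorings G" using 3(3) by simp
  ultimately show ?case
    using frac_combination[OF fin _ _ _ IH(1), of l f] l l1 IH(2) by (simp del: list.map add: list.map(2)[of _ "(l, f)"])
qed auto

section \<open>Restriction to a subgraph\<close>

text \<open>The image of the weights under \<open>S \<mapsto> S \<inter> pverts H\<close>. The
  weight arriving at the empty set is discarded: it belongs to colors that do not occur in
  \<open>H\<close>.\<close>

definition restrict_weighting ::
    "'a pair_pre_digraph \<Rightarrow> 'a pair_pre_digraph \<Rightarrow> ('a set \<Rightarrow> rat) \<Rightarrow> 'a set \<Rightarrow> rat" where
  "restrict_weighting G H w T =
     (if T = {} then 0 else \<Sum>S | S \<in> Pow (pverts G) \<and> S \<inter> pverts H = T. w S)"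

text \<open>Only agreement on \<open>H\<close> is asked of \<open>c'\<close>, so the statement
  covers both the truncated coloring in \<open>frac_restrict\<close> and the original coloring read
  on \<open>H\<close>, as in gluing.\<close>

lemma class_weight_restrict:
  assumes fin: "finite (pverts G)" and V: "pverts H \<subseteq> pverts G"
    and bc: "(b, c) \<in> multifold_colorings G"
    and r: "\<And>v. v \<in> pverts H \<Longrightarrow> c' v = c v"
  shows "class_weight H (b, c') = restrict_weighting G H (class_weight G (b, c))"
proof
  fix T
  have cls: "color_class H c' x = color_class G c x \<inter> pverts H" for x
    using V r by (auto simp: color_class_def)
  show "class_weight H (b, c') T = restrict_weighting G H (class_weight G (b, c)) T"
  proof (cases "T = {}")
    case True
    have "{x \<in> used_colors H c'. color_class H c' x = {}} = {}"
      by (auto simp: used_colors_iff)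
    then have "class_size H c' {} = 0" unfolding class_size_def by (simp only: card.empty)
    then show ?thesis using True by (simp add: class_weight_def restrict_weighting_def)
  next
    case False
    have "{x \<in> used_colors H c'. color_class H c' x = T} =
        {x \<in> used_colors G c. color_class G c x \<inter> pverts H = T}"
      using False by (auto simp: used_colors_iff cls)
    then have "class_size H c' T = card {x \<in> used_colors G c. color_class G c x \<inter> pverts H = T}"
      by (simp add: class_size_def)
    also have "\<dots> = (\<Sum>S | S \<in> Pow (pverts G) \<and> S \<inter> pverts H = T. class_size G c S)"
      using card_colors_eq_sum[OF fin, of c "\<lambda>S. S \<inter> pverts H = T"] finite_used_colors[OF fin, of b c] bc
      by (simp add: multifold_colorings_iff)
    finally show ?thesis
      using False by (simp add: class_weight_def restrict_weighting_def sum_divide_distrib)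
  qed
qed

text \<open>The last claim keeps the bound \<open>t\<close> under restriction: colors can only
  disappear while the fold number stays the same.\<close>

lemma frac_restrict:
  assumes fin: "finite (pverts G)" and V: "pverts H \<subseteq> pverts G" and E: "parcs H \<subseteq> parcs G"
    and wf: "\<And>u v. (u, v) \<in> parcs H \<Longrightarrow> u \<in> pverts H \<and> v \<in> pverts H"
    and f: "f \<in> frac_colorings G"
  shows "frac_restrict H f \<in> frac_colorings H"
    and "weighting_of H (frac_restrict H f) = restrict_weighting G H (weighting_of G f)"
    and "total_weight H (restrict_weighting G H (weighting_of G f)) \<le> total_weight G (weighting_of G f)"
proof -
  have finH: "finite (pverts H)" using V fin by (rule finite_subset)
  define h where "h = (\<lambda>(b, c). (b, \<lambda>v. if v \<in> pverts H then c v else {}) :: nat \<times> ('a \<Rightarrow> nat set))"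
  have R: "frac_restrict H f = (\<Union>a\<in>f. frac_rel H `` {h a})"
    by (auto simp: frac_restrict_def h_def)
  have mem: "h (b, c) \<in> multifold_colorings H" if bc: "(b, c) \<in> multifold_colorings G" for b c
    using bc V E wf by (force simp: h_def multifold_colorings_def subset_iff)
  have h: "h a \<in> multifold_colorings H" "class_weight H (h a) = restrict_weighting G H (weighting_of G f)"
    if a: "a \<in> f" for a
  proof -
    obtain b c where bc: "a = (b, c)" by force
    have m: "(b, c) \<in> multifold_colorings G" "class_weight G (b, c) = weighting_of G f"
      using weighting_of_rep[OF fin f] a bc by auto
    show "h a \<in> multifold_colorings H" using mem m(1) bc by simp
    show "class_weight H (h a) = restrict_weighting G H (weighting_of G f)"
      using class_weight_restrict[OF fin V m(1)] m(2) by (simp add: h_def bc)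
  qed
  have ne: "f \<noteq> {}" using frac_coloring_nonempty[OF fin f] by blast
  show "frac_restrict H f \<in> frac_colorings H"
    unfolding R using h by (intro weighting_of_UN(1)[OF finH ne]) auto
  show "weighting_of H (frac_restrict H f) = restrict_weighting G H (weighting_of G f)"
    unfolding R using h by (intro weighting_of_UN(2)[OF finH ne]) auto
  obtain b c where a: "(b, c) \<in> f" using ne by force
  have m: "(b, c) \<in> multifold_colorings G" "class_weight G (b, c) = weighting_of G f"
    using weighting_of_rep[OF fin f a] by auto
  obtain c' where c': "h (b, c) = (b, c')" "\<And>v. v \<in> pverts H \<Longrightarrow> c' v = c v" by (simp add: h_def)
  have "used_colors H c' \<subseteq> used_colors G c"
    using V c'(2) by (auto simp: used_colors_def)
  then have "card (used_colors H c') \<le> card (used_colors G c)"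
    using finite_used_colors[OF fin] m(1) by (intro card_mono) (auto simp: multifold_colorings_iff)
  then have "total_weight H (class_weight H (b, c')) \<le> total_weight G (class_weight G (b, c))"
    using total_class_weight[OF fin m(1)] total_class_weight[OF finH, of b c'] mem[OF m(1)] c'(1)
    by (simp add: divide_right_mono)
  then show "total_weight H (restrict_weighting G H (weighting_of G f)) \<le> total_weight G (weighting_of G f)"
    using h(2)[OF a] c'(1) m(2) by simp
qed

lemma restrict_weighting_combination:
  "restrict_weighting G H (\<lambda>S. a * w1 S + b * w2 S) =
    (\<lambda>T. a * restrict_weighting G H w1 T + b * restrict_weighting G H w2 T)"
  by (auto simp: restrict_weighting_def sum.distrib sum_distrib_left)

section \<open>Vertices of the polytope of weightings\<close>

text \<open>The coordinate \<open>None\<close> is the slack of the inequality \<open>total_weight G w \<le> t\<close>.\<close>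

definition coordinate ::
    "'a pair_pre_digraph \<Rightarrow> rat \<Rightarrow> ('a set \<Rightarrow> rat) \<Rightarrow> 'a set option \<Rightarrow> rat" where
  "coordinate G t w i = (case i of None \<Rightarrow> t - total_weight G w | Some S \<Rightarrow> w S)"

definition support ::
    "'a pair_pre_digraph \<Rightarrow> rat \<Rightarrow> ('a set \<Rightarrow> rat) \<Rightarrow> 'a set option set" where
  "support G t w = {i \<in> insert None (Some ` Pow (pverts G)). coordinate G t w i \<noteq> 0}"

text \<open>The vanishing coordinates of \<open>w\<close> cut out the smallest face containing it;
  \<open>w\<close> is a vertex when this face is a single point. These are the basic feasible
  solutions, described without linear independence.\<close>

definition vertex :: "'a pair_pre_digraph \<Rightarrow> rat \<Rightarrow> ('a set \<Rightarrow> rat) \<Rightarrow> bool" where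
  "vertex G t w \<longleftrightarrow> w \<in> weightings_le G t \<and>
     (\<forall>w'\<in>weightings_le G t. support G t w' \<subseteq> support G t w \<longrightarrow> w' = w)"

lemma finite_support: "finite (pverts G) \<Longrightarrow> finite (support G t w)"
  by (simp add: support_def)

lemma total_weight_combination:
  "total_weight G (\<lambda>S. a * w1 S + b * w2 S) = a * total_weight G w1 + b * total_weight G w2"
  by (simp add: total_weight_def sum.distrib sum_distrib_left)

lemma weightings_le_convex:
  assumes w: "w1 \<in> weightings_le G t" "w2 \<in> weightings_le G t" and l: "0 \<le> l" "l \<le> 1"
  shows "(\<lambda>S. l * w1 S + (1 - l) * w2 S) \<in> weightings_le G t"
proof -
  have "total_weight G (\<lambda>S. l * w1 S + (1 - l) * w2 S) \<le> l * t + (1 - l) * t"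
    unfolding total_weight_combination using w l
    by (intro add_mono mult_left_mono) (auto simp: weightings_le_def)
  then have "total_weight G (\<lambda>S. l * w1 S + (1 - l) * w2 S) \<le> t" by (simp add: algebra_simps)
  moreover have "(\<Sum>S | S \<in> Pow (pverts G) \<and> v \<in> S. l * w1 S + (1 - l) * w2 S) = 1"
    if "v \<in> pverts G" for v
    using w that by (simp add: sum.distrib weightings_le_def weightings_def flip: sum_distrib_left)
  moreover have "w1 S \<noteq> 0 \<or> w2 S \<noteq> 0" if "l * w1 S + (1 - l) * w2 S \<noteq> 0" for S
    using that by auto
  ultimately show ?thesis
    using w l unfolding weightings_le_def weightings_def mem_Collect_eq
    by (intro conjI allI impI ballI) (simp_all, blast+)
qed

text \<open>The ratio test of the simplex method. As \<open>d\<close> vanishes wherever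
  \<open>x\<close> does, every decreasing coordinate starts out positive, so the step is positive
  and a coordinate that was not zero becomes zero.\<close>

lemma ratio_test:
  fixes x d :: "'i \<Rightarrow> rat"
  assumes "finite I" and x: "\<And>i. i \<in> I \<Longrightarrow> 0 \<le> x i" and d: "\<And>i. i \<in> I \<Longrightarrow> x i = 0 \<Longrightarrow> d i = 0"
    and j: "j \<in> I" "d j < 0"
  obtains s k where "s > 0" and "\<And>i. i \<in> I \<Longrightarrow> 0 \<le> x i + s * d i"
    and "k \<in> I" and "x k \<noteq> 0" and "x k + s * d k = 0"
proof -
  define J where "J = {i \<in> I. d i < 0}"
  \<comment> \<open>The first moment at which a decreasing coordinate reaches zero.\<close>
  define s where "s = Min ((\<lambda>i. x i / - d i) ` J)"
  have J: "finite J" "J \<noteq> {}" using assms(1) j by (auto simp: J_def)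
  then have "s \<in> (\<lambda>i. x i / - d i) ` J" unfolding s_def by (intro Min_in) auto
  then obtain k where k: "k \<in> I" "d k < 0" "s = x k / - d k" by (auto simp: J_def)
  have xk: "x k > 0" using x[OF k(1)] d[OF k(1)] k(2) by force
  then have s: "s > 0" using k by (simp add: divide_pos_neg)
  have "0 \<le> x i + s * d i" if i: "i \<in> I" for i
  proof (cases "d i < 0")
    case True
    then have "s \<le> x i / - d i" unfolding s_def using J i by (intro Min_le) (auto simp: J_def)
    then have "s * - d i \<le> x i" using True pos_le_divide_eq[of "- d i" s "x i"] by simp
    then show ?thesis by simp
  next
    case False
    then show ?thesis using x[OF i] s by simp
  qed
  moreover have "x k + s * d k = 0" using k by simp
  ultimately show ?thesis using that s k(1) xk by auto
qed

text \<open>The conditions on \<open>d\<close> say that it is a direction inside the smallest face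
  containing \<open>w\<close>. All equations and all vanishing coordinates are thus preserved, and
  the move ends on a proper subface.\<close>

lemma move_to_face:
  assumes fin: "finite (pverts G)" and w: "w \<in> weightings_le G t"
    and d: "\<And>S. w S = 0 \<Longrightarrow> d S = 0" "total_weight G w = t \<Longrightarrow> total_weight G d = 0"
      "\<And>v. v \<in> pverts G \<Longrightarrow> (\<Sum>S | S \<in> Pow (pverts G) \<and> v \<in> S. d S) = 0"
    and nz: "d S0 \<noteq> 0"
  obtains s where "s > 0" and "(\<lambda>S. w S + s * d S) \<in> weightings_le G t"
    and "support G t (\<lambda>S. w S + s * d S) \<subset> support G t w"
proof -
  let ?I = "insert None (Some ` Pow (pverts G))"
  \<comment> \<open>The bound 0 for \<open>d\<close> is deliberate: the slack of
    \<open>w + s * d\<close> is the slack of \<open>w\<close> minus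
    \<open>s * total_weight G d\<close>, so the direction has slack coordinate
    \<open>- total_weight G d\<close>.\<close>
  let ?x = "coordinate G t w" and ?d = "coordinate G 0 d"
  have wG: "w \<in> weightings G" "total_weight G w \<le> t" using w by (auto simp: weightings_le_def)
  \<comment> \<open>Some coordinate must decrease: a nonnegative \<open>d\<close> whose sum over the
    sets containing a vertex \<open>v\<close> of \<open>S0\<close> is 0 would vanish at
    \<open>S0\<close>.\<close>
  have "\<exists>S\<in>Pow (pverts G). d S < 0"
  proof (rule ccontr)
    assume "\<not> ?thesis"
    then have nonneg: "\<And>S. S \<in> Pow (pverts G) \<Longrightarrow> 0 \<le> d S" by (meson not_less)
    have "w S0 \<noteq> 0" using d(1) nz by blast
    then have "S0 \<subseteq> pverts G" "S0 \<noteq> {}" using wG(1) by (auto simp: weightings_def)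
    then obtain v where S0: "S0 \<subseteq> pverts G" "v \<in> S0" by blast
    let ?A = "{S. S \<in> Pow (pverts G) \<and> v \<in> S}"
    have "v \<in> pverts G" using S0 by blast
    then have "sum d ?A = 0" by (rule d(3))
    moreover have "sum d ?A = 0 \<longleftrightarrow> (\<forall>S\<in>?A. d S = 0)"
      by (rule sum_nonneg_eq_0_iff) (use fin nonneg in auto)
    ultimately have "\<forall>S\<in>?A. d S = 0" by blast
    then show False using S0 nz by auto
  qed
  then obtain S where S: "S \<in> Pow (pverts G)" "d S < 0" by blast
  obtain s k where s: "s > 0" and nn: "\<And>i. i \<in> ?I \<Longrightarrow> 0 \<le> ?x i + s * ?d i"
    and k: "k \<in> ?I" "?x k \<noteq> 0" "?x k + s * ?d k = 0"
  proof (rule ratio_test[of ?I ?x ?d "Some S"])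
    show "finite ?I" using fin by simp
    show "0 \<le> ?x i" for i using wG by (auto simp: coordinate_def weightings_def split: option.split)
    show "?x i = 0 \<Longrightarrow> ?d i = 0" for i using d(1,2) by (auto simp: coordinate_def split: option.splits)
    show "Some S \<in> ?I" "?d (Some S) < 0" using S by (auto simp: coordinate_def)
  qed (rule that)
  define u where "u = (\<lambda>S. w S + s * d S)"
  have total: "total_weight G u = total_weight G w + s * total_weight G d"
    using total_weight_combination[of G 1 w s d] by (simp add: u_def)
  have coord: "coordinate G t u i = ?x i + s * ?d i" for i
  proof (cases i)
    case None
    then show ?thesis by (simp add: coordinate_def total algebra_simps)
  next
    case (Some S)
    then show ?thesis by (simp add: coordinate_def u_def)
  qed
  have u0: "w S = 0 \<Longrightarrow> u S = 0" for S using d(1) by (simp add: u_def)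
  have "0 \<le> u S" for S
  proof (cases "S \<in> Pow (pverts G)")
    case True
    then show ?thesis using nn[of "Some S"] by (simp add: coordinate_def u_def)
  next
    case False
    then have "w S = 0" using wG(1) by (auto simp: weightings_def)
    then show ?thesis using u0 by simp
  qed
  moreover have "(\<Sum>S | S \<in> Pow (pverts G) \<and> v \<in> S. u S) = 1" if "v \<in> pverts G" for v
    using d(3)[OF that] wG(1) that
    by (simp add: u_def sum.distrib weightings_def flip: sum_distrib_left)
  moreover have "total_weight G u \<le> t"
    using nn[of None] total by (simp add: coordinate_def)
  ultimately have "u \<in> weightings_le G t"
    using wG(1) u0 unfolding weightings_le_def weightings_def mem_Collect_eq by metis
  moreover have "support G t u \<subset> support G t w"
  proof
    show "support G t u \<subseteq> support G t w"
      using u0 d(2) by (auto simp: support_def coordinate_def total)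
    show "support G t u \<noteq> support G t w"
      using k coord[of k] by (auto simp: support_def)
  qed
  ultimately show ?thesis using that[OF s] by (simp add: u_def)
qed

text \<open>Stated as an induction rule, the decomposition into vertices needs no lists of
  coefficients. It serves twice: for extending weightings from \<open>H\<close> to
  \<open>G2\<close>, and for bounding the total weight from below by that of a vertex.\<close>

lemma vertex_induct:
  assumes fin: "finite (pverts G)" and "w \<in> weightings_le G t"
    and vert: "\<And>w. vertex G t w \<Longrightarrow> Q w"
    and conv: "\<And>w1 w2 l. \<lbrakk>Q w1; Q w2; 0 < l; l < 1\<rbrakk> \<Longrightarrow> Q (\<lambda>S. l * w1 S + (1 - l) * w2 S)"
  shows "Q w"
  using assms(2)
proof (induction "card (support G t w)" arbitrary: w rule: less_induct)
  case less
  show ?case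
  proof (cases "vertex G t w")
    case False
    then obtain w' where w': "w' \<in> weightings_le G t" "support G t w' \<subseteq> support G t w" "w' \<noteq> w"
      using less.prems by (auto simp: vertex_def)
    \<comment> \<open>A difference of two feasible points satisfies the homogeneous equations, and
      so does its negative; hence both directions are open.\<close>
    define d where "d = (\<lambda>S. w' S - w S)"
    have wG: "w \<in> weightings G" "w' \<in> weightings G" using less.prems w'(1) by (auto simp: weightings_le_def)
    obtain S0 where S0: "d S0 \<noteq> 0" using w'(3) by (auto simp: d_def fun_eq_iff)
    have d1: "d S = 0" if "w S = 0" for S
    proof (cases "S \<in> Pow (pverts G)")
      case True
      have "Some S \<notin> support G t w" using that by (simp add: support_def coordinate_def)
      then have "Some S \<notin> support G t w'" using w'(2) by blast
      then show ?thesis using True that by (simp add: support_def coordinate_def d_def)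
    next
      case False
      then have "w S = 0" "w' S = 0" using wG by (auto simp: weightings_def)
      then show ?thesis by (simp add: d_def)
    qed
    have d2: "total_weight G d = 0" if "total_weight G w = t"
    proof -
      have "None \<notin> support G t w" using that by (simp add: support_def coordinate_def)
      then have "None \<notin> support G t w'" using w'(2) by blast
      then have "total_weight G w' = t" by (simp add: support_def coordinate_def)
      then show ?thesis using that by (simp add: d_def total_weight_def sum_subtractf)
    qed
    have d3: "(\<Sum>S | S \<in> Pow (pverts G) \<and> v \<in> S. d S) = 0" if "v \<in> pverts G" for v
      using wG that by (simp add: d_def weightings_def sum_subtractf)
    obtain s1 where s1: "s1 > 0" "(\<lambda>S. w S + s1 * d S) \<in> weightings_le G t"
        "support G t (\<lambda>S. w S + s1 * d S) \<subset> support G t w"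
      using move_to_face[where d = d, OF fin less.prems d1 d2 d3 S0] .
    obtain s2 where s2: "s2 > 0" "(\<lambda>S. w S + s2 * - d S) \<in> weightings_le G t"
        "support G t (\<lambda>S. w S + s2 * - d S) \<subset> support G t w"
    proof (rule move_to_face[where d = "\<lambda>S. - d S", OF fin less.prems])
      show "- d S = 0" if "w S = 0" for S using d1[OF that] by simp
      show "total_weight G (\<lambda>S. - d S) = 0" if "total_weight G w = t"
        using d2[OF that] by (simp add: total_weight_def sum_negf)
      show "(\<Sum>S | S \<in> Pow (pverts G) \<and> v \<in> S. - d S) = 0" if "v \<in> pverts G" for v
        using d3[OF that] by (simp add: sum_negf)
      show "- d S0 \<noteq> 0" using S0 by simp
    qed (rule that)
    have "Q (\<lambda>S. w S + s1 * d S)" "Q (\<lambda>S. w S + s2 * - d S)"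
      using less.hyps[OF _ s1(2)] less.hyps[OF _ s2(2)] psubset_card_mono[OF finite_support[OF fin]]
        s1(3) s2(3) by blast+
    \<comment> \<open>Chosen so that \<open>l * s1 = (1 - l) * s2\<close>: the two opposite
      displacements cancel.\<close>
    moreover define l where "l = s2 / (s1 + s2)"
    moreover have l: "0 < l" "l < 1" using s1(1) s2(1) by (auto simp: l_def)
    ultimately have "Q (\<lambda>S. l * (w S + s1 * d S) + (1 - l) * (w S + s2 * - d S))"
      by (intro conv)
    moreover have "l * (w S + s1 * d S) + (1 - l) * (w S + s2 * - d S) = w S" for S
    proof -
      have "l * s1 = (1 - l) * s2" using s1(1) s2(1) by (simp add: l_def field_simps)
      moreover have "l * (w S + s1 * d S) + (1 - l) * (w S + s2 * - d S) =
          w S + (l * s1 - (1 - l) * s2) * d S" by (simp add: algebra_simps)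
      ultimately show ?thesis by simp
    qed
    ultimately show ?thesis by simp
  qed (rule vert)
qed

text \<open>A vertex is the only feasible point on its support, and there are finitely many
  supports.\<close>

lemma finite_vertices:
  assumes "finite (pverts G)"
  shows "finite {w. vertex G t w}"
proof (rule finite_imageD)
  have "support G t ` {w. vertex G t w} \<subseteq> Pow (insert None (Some ` Pow (pverts G)))"
    by (auto simp: support_def)
  then show "finite (support G t ` {w. vertex G t w})"
    by (rule finite_subset) (use assms in simp)
  show "inj_on (support G t) {w. vertex G t w}"
    by (rule inj_onI) (simp add: vertex_def)
qed

section \<open>From vertices to extremal fractional colorings\<close>

text \<open>The slack is affine and not linear in \<open>w\<close>; coefficients with sum 1 are what
  lets it commute with the combination.\<close>

lemma coordinate_sum_list:
  assumes "sum_list (map fst xs) = 1"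
  shows "coordinate G t (\<lambda>S. \<Sum>(l, w)\<leftarrow>xs. l * w S) i = (\<Sum>(l, w)\<leftarrow>xs. l * coordinate G t w i)"
proof (cases i)
  case None
  have "sum_list (map fst xs) * t - total_weight G (\<lambda>S. \<Sum>(l, w)\<leftarrow>xs. l * w S) =
      (\<Sum>(l, w)\<leftarrow>xs. l * (t - total_weight G w))"
    by (induction xs) (auto simp: total_weight_def sum.distrib sum_distrib_left algebra_simps)
  then show ?thesis using None assms by (simp add: coordinate_def)
qed (simp add: coordinate_def)

text \<open>In a combination with positive coefficients, nonnegative coordinates cannot cancel, so
  each member is supported within the support of \<open>f\<close>. At a vertex every member then
  equals \<open>f\<close>, against having two distinct ones.\<close>

lemma extremal_if_vertex:
  assumes fin: "finite (pverts G)" and f: "f \<in> frac_colorings_le G t"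
    and v: "vertex G t (weighting_of G f)"
  shows "extremal G t f"
  unfolding extremal_def
proof (intro conjI notI f)
  assume "\<exists>xs. length xs \<ge> 2 \<and> distinct (map snd xs) \<and> set (map snd xs) \<subseteq> frac_colorings_le G t \<and>
            (\<forall>l\<in>set (map fst xs). l > 0) \<and> sum_list (map fst xs) = 1 \<and> f = frac_lin_comb G xs"
  then obtain xs where xs: "length xs \<ge> 2" "distinct (map snd xs)"
    "set (map snd xs) \<subseteq> frac_colorings_le G t" "\<forall>l\<in>set (map fst xs). l > 0"
    "sum_list (map fst xs) = 1" "f = frac_lin_comb G xs" by blast
  have cls: "set (map snd xs) \<subseteq> frac_colorings G"
    using xs(3) by (auto simp: frac_colorings_le_def)
  let ?ys = "map (\<lambda>(l, h). (l, weighting_of G h)) xs"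
  have "weighting_of G f = (\<lambda>S. \<Sum>(l, w)\<leftarrow>?ys. l * w S)"
    using frac_lin_comb[OF fin cls xs(4,5)] xs(6) by (simp add: o_def split_def)
  moreover have "sum_list (map fst ?ys) = 1" using xs(5) by (simp add: o_def split_def)
  ultimately have coord: "coordinate G t (weighting_of G f) i =
      (\<Sum>(l, h)\<leftarrow>xs. l * coordinate G t (weighting_of G h) i)" for i
    using coordinate_sum_list[of ?ys G t i] by (simp add: o_def split_def)
  have "h = f" if h: "(l, h) \<in> set xs" for l h
  proof -
    have le: "weighting_of G h' \<in> weightings_le G t" if "(l', h') \<in> set xs" for l' h'
    proof -
      have "h' \<in> set (map snd xs)" using that by force
      then show ?thesis using xs(3) cls frac_colorings_le_iff[OF fin] by blast
    qed
    have pos: "l' > 0" if "(l', h') \<in> set xs" for l' h' using xs(4) that by force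
    have "support G t (weighting_of G h) \<subseteq> support G t (weighting_of G f)"
    proof
      fix i assume i: "i \<in> support G t (weighting_of G h)"
      have nn: "0 \<le> coordinate G t (weighting_of G h') i" if "(l', h') \<in> set xs" for l' h'
        using le[OF that] by (auto simp: coordinate_def weightings_le_def weightings_def split: option.split)
      have "coordinate G t (weighting_of G h) i \<noteq> 0" using i by (simp add: support_def)
      then have "0 < l * coordinate G t (weighting_of G h) i" using nn[OF h] pos[OF h] by simp
      also have "\<dots> \<le> coordinate G t (weighting_of G f) i"
        unfolding coord
      proof (rule member_le_sum_list)
        show "l * coordinate G t (weighting_of G h) i \<in>
            set (map (\<lambda>(l, h). l * coordinate G t (weighting_of G h) i) xs)"
          using h by (force simp: image_iff)
        show "0 \<le> y" if "y \<in> set (map (\<lambda>(l, h). l * coordinate G t (weighting_of G h) i) xs)" for y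
          using that nn pos by (auto intro!: mult_nonneg_nonneg intro: less_imp_le)
      qed
      finally show "i \<in> support G t (weighting_of G f)" using i by (simp add: support_def)
    qed
    then have "weighting_of G h = weighting_of G f"
      using v le[OF h] by (simp add: vertex_def)
    moreover have "h \<in> set (map snd xs)" using h by force
    then have "h \<in> frac_colorings G" using cls by blast
    moreover have "f \<in> frac_colorings G" using f by (simp add: frac_colorings_le_def)
    ultimately show "h = f" using weighting_of_inject[OF fin] by blast
  qed
  then have "set (map snd xs) \<subseteq> {f}" by auto
  then have "card (set (map snd xs)) \<le> 1" using card_mono[of "{f}"] by fastforce
  then show False using xs(1) distinct_card[OF xs(2)] by simp
qed

section \<open>The fractional chromatic number as an attained minimum\<close>

text \<open>\<open>LEAST\<close> over the rationals says nothing until a minimum is exhibited. It is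
  found among the finitely many vertices, since each weighting below the cutoff has at least the
  total weight of some vertex.\<close>

lemma frac_chromatic_number_attained:
  assumes fin: "finite (pverts G)" and ne: "f0 \<in> frac_colorings G"
  obtains f where "f \<in> frac_colorings G" and "color_ratio G f = frac_chromatic_number G"
    and "\<And>h. h \<in> frac_colorings G \<Longrightarrow> frac_chromatic_number G \<le> color_ratio G h"
proof -
  \<comment> \<open>A cutoff that makes the polytope nonempty; colorings with a larger ratio cannot
    compete.\<close>
  define t where "t = color_ratio G f0"
  define V where "V = {w. vertex G t w}"
  define m where "m = Min (total_weight G ` V)"
  have le: "\<exists>v\<in>V. total_weight G v \<le> total_weight G w" if "w \<in> weightings_le G t" for w
    using fin that
  proof (rule vertex_induct)
    fix w1 w2 and l :: rat
    assume *: "\<exists>v\<in>V. total_weight G v \<le> total_weight G w1"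
      "\<exists>v\<in>V. total_weight G v \<le> total_weight G w2" "0 < l" "l < 1"
    \<comment> \<open>Total weight is linear, so a convex combination weighs at least as much as its
      lighter part.\<close>
    have "min (total_weight G w1) (total_weight G w2) =
        l * min (total_weight G w1) (total_weight G w2) + (1 - l) * min (total_weight G w1) (total_weight G w2)"
      by (simp add: algebra_simps)
    also have "\<dots> \<le> total_weight G (\<lambda>S. l * w1 S + (1 - l) * w2 S)"
      unfolding total_weight_combination using * by (intro add_mono mult_left_mono) auto
    finally show "\<exists>v\<in>V. total_weight G v \<le> total_weight G (\<lambda>S. l * w1 S + (1 - l) * w2 S)"
      using * by (meson min_le_iff_disj order_trans)
  qed (auto simp: V_def)
  have t: "weighting_of G f0 \<in> weightings_le G t"
    using frac_colorings_le_iff[OF fin ne, of t] ne by (simp add: t_def frac_colorings_le_def)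
  have finV: "finite V" unfolding V_def by (rule finite_vertices[OF fin])
  have "V \<noteq> {}" using le[OF t] by auto
  then have "m \<in> total_weight G ` V" unfolding m_def using finV by (intro Min_in) auto
  then obtain w where w: "vertex G t w" "total_weight G w = m" by (auto simp: V_def)
  have wG: "w \<in> weightings G" "m \<le> t" using w by (auto simp: vertex_def weightings_le_def)
  obtain f where f: "f \<in> frac_colorings G" "weighting_of G f = w" using weighting_of_surj[OF fin wG(1)] .
  have fm: "color_ratio G f = m" using color_ratio_eq[OF fin f(1)] f(2) w(2) by simp
  have lower: "m \<le> color_ratio G h" if h: "h \<in> frac_colorings G" for h
  proof (cases "color_ratio G h \<le> t")
    case True
    then have "weighting_of G h \<in> weightings_le G t"
      using frac_colorings_le_iff[OF fin h, of t] h by (simp add: frac_colorings_le_def)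
    then obtain v where "v \<in> V" "total_weight G v \<le> total_weight G (weighting_of G h)" using le by blast
    moreover have "m \<le> total_weight G v" unfolding m_def using finV \<open>v \<in> V\<close> by (intro Min_le) auto
    ultimately show ?thesis using color_ratio_eq[OF fin h] by simp
  qed (use wG(2) in simp)
  have "frac_chromatic_number G = m"
    unfolding frac_chromatic_number_def using f(1) fm lower by (intro Least_equality) auto
  then show ?thesis using that f(1) fm lower by simp
qed

section \<open>Gluing\<close>

text \<open>Giving each vertex a color of its own is a 1-fold coloring.\<close>

lemma frac_colorings_nonempty:
  assumes fin: "finite (pverts G)" and loopfree: "\<And>v. (v, v) \<notin> parcs G"
  obtains f where "f \<in> frac_colorings G"
proof -
  obtain e :: "'a \<Rightarrow> nat" where e: "inj_on e (pverts G)"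
    using finite_imp_inj_to_nat_seg[OF fin] by auto
  define c where "c v = (if v \<in> pverts G then {e v} else {})" for v
  have "c u \<inter> c v = {}" if "(u, v) \<in> parcs G" for u v
    using that loopfree[of u] e by (auto simp: c_def inj_on_def)
  then have "(1, c) \<in> multifold_colorings G"
    by (auto simp: multifold_colorings_def) (auto simp: c_def)
  then have "frac_rel G `` {(1, c)} \<in> frac_colorings G"
    unfolding frac_colorings_def by (rule quotientI)
  then show ?thesis by (rule that)
qed

lemma class_weight_mult:
  assumes fin: "finite (pverts G)" and "(b, c) \<in> multifold_colorings G" and "s > 0"
  shows "(s * b, coloring_mult s c) \<in> multifold_colorings G"
    and "class_weight G (s * b, coloring_mult s c) = class_weight G (b, c)"
  using assms fold_coloring_mult class_size_mult[OF fin, of b c s]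
  by (auto simp: multifold_colorings_iff class_weight_def)

text \<open>
  The colors of the coloring with fewer colors are renamed to colors of the other one with the same
  class in \<open>H\<close>; colors not occurring in \<open>H\<close> are matched arbitrarily.
\<close>

lemma glue_colorings:
  fixes G G1 G2 H :: "'a pair_pre_digraph"
  assumes fin: "finite (pverts G)"
    and wf1: "\<And>u v. (u, v) \<in> parcs G1 \<Longrightarrow> u \<in> pverts G1 \<and> v \<in> pverts G1"
    and wf2: "\<And>u v. (u, v) \<in> parcs G2 \<Longrightarrow> u \<in> pverts G2 \<and> v \<in> pverts G2"
    and G: "pverts G = pverts G1 \<union> pverts G2" "parcs G = parcs G1 \<union> parcs G2"
    and H: "pverts H = pverts G1 \<inter> pverts G2"
    and c1: "(b, c1) \<in> multifold_colorings G1" and c2: "(b, c2) \<in> multifold_colorings G2"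
    and agree: "class_size H c1 = class_size H c2"
    and le: "card (used_colors G1 c1) \<le> card (used_colors G2 c2)"
  obtains c where "(b, c) \<in> multifold_colorings G"
    and "card (used_colors G c) \<le> card (used_colors G2 c2)"
proof -
  have finG: "finite (pverts G1)" "finite (pverts G2)" "finite (pverts H)" using fin G H by auto
  have finU: "finite (used_colors G1 c1)" "finite (used_colors G2 c2)"
    using finite_used_colors finG c1 c2 by (auto simp: multifold_colorings_iff)
  have sub: "used_colors H c1 \<subseteq> used_colors G1 c1" "used_colors H c2 \<subseteq> used_colors G2 c2"
    using H by (auto simp: used_colors_def)
  then have finH: "finite (used_colors H c1)" "finite (used_colors H c2)"
    using finU by (auto intro: finite_subset)
  have cardH: "card (used_colors H c1) = card (used_colors H c2)"
    using card_colors_eq_sum[OF finG(3) finH(1), of "\<lambda>_. True"]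
      card_colors_eq_sum[OF finG(3) finH(2), of "\<lambda>_. True"] agree by simp
  \<comment> \<open>For nonempty \<open>S\<close> the two counts agree by \<open>agree\<close>. Only
    the colors missing \<open>H\<close> can differ in number; there the common number of colors in
    \<open>H\<close> is subtracted from both sides of \<open>le\<close>.\<close>
  have fibers: "card {x \<in> used_colors G1 c1. color_class H c1 x = S} \<le>
      card {y \<in> used_colors G2 c2. color_class H c2 y = S}" for S
  proof (cases "S = {}")
    case True
    then have "{x \<in> used_colors G1 c1. color_class H c1 x = S} = used_colors G1 c1 - used_colors H c1"
      "{y \<in> used_colors G2 c2. color_class H c2 y = S} = used_colors G2 c2 - used_colors H c2"
      by (auto simp: used_colors_iff)
    then show ?thesis
      using le cardH sub finH by (simp add: card_Diff_subset diff_le_mono)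
  next
    case False
    then have "{x \<in> used_colors G1 c1. color_class H c1 x = S} =
        {x \<in> used_colors H c1. color_class H c1 x = S}"
      "{y \<in> used_colors G2 c2. color_class H c2 y = S} =
        {y \<in> used_colors H c2. color_class H c2 y = S}"
      using subsetD[OF sub(1)] subsetD[OF sub(2)] by (auto simp: used_colors_iff[of _ H])
    then show ?thesis using fun_cong[OF agree, of S] by (simp add: class_size_def)
  qed
  obtain \<phi> where \<phi>: "inj_on \<phi> (used_colors G1 c1)" "\<phi> ` used_colors G1 c1 \<subseteq> used_colors G2 c2"
    "\<And>x. x \<in> used_colors G1 c1 \<Longrightarrow> color_class H c2 (\<phi> x) = color_class H c1 x"
    by (rule fiberwise_injection[OF finU fibers]) (rule that)
  have used1: "c1 v \<subseteq> used_colors G1 c1" if "v \<in> pverts G1" for v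
    using that by (auto simp: used_colors_def)
  \<comment> \<open>Preserving traces on \<open>H\<close> gives one inclusion; both sides have
    \<open>b\<close> elements.\<close>
  have overlap: "\<phi> ` c1 v = c2 v" if v: "v \<in> pverts G1" "v \<in> pverts G2" for v
  proof (rule card_seteq)
    show "finite (c2 v)" using c2 v by (auto simp: multifold_colorings_def)
    show "\<phi> ` c1 v \<subseteq> c2 v"
    proof
      fix y assume "y \<in> \<phi> ` c1 v"
      then obtain x where x: "x \<in> c1 v" "y = \<phi> x" by blast
      then have "v \<in> color_class H c1 x" using v H by (simp add: color_class_def)
      then have "v \<in> color_class H c2 y" using \<phi>(3)[of x] x used1[OF v(1)] by auto
      then show "y \<in> c2 v" by (simp add: color_class_def)
    qed
    have "card (\<phi> ` c1 v) = card (c1 v)"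
      using inj_on_subset[OF \<phi>(1) used1[OF v(1)]] by (rule card_image)
    then show "card (c2 v) \<le> card (\<phi> ` c1 v)"
      using c1 c2 v by (simp add: multifold_colorings_def)
  qed
  define c where "c v = (if v \<in> pverts G1 then \<phi> ` c1 v else c2 v)" for v
  have c_2: "c v = c2 v" if "v \<in> pverts G2" for v
    using overlap that by (simp add: c_def)
  have c_1: "finite (c v)" "card (c v) = b" if "v \<in> pverts G1" for v
    using that c1 card_image[OF inj_on_subset[OF \<phi>(1) used1[OF that]]]
    by (auto simp: c_def multifold_colorings_def)
  \<comment> \<open>Each arc lies in one of the two parts, and on that part \<open>c\<close> is an
    injective renaming of \<open>c1\<close> or equal to \<open>c2\<close>.\<close>
  have "c u \<inter> c v = {}" if uv: "(u, v) \<in> parcs G" for u v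
  proof (cases "(u, v) \<in> parcs G1")
    case True
    then have "u \<in> pverts G1" "v \<in> pverts G1" "c1 u \<inter> c1 v = {}"
      using wf1 c1 by (auto simp: multifold_colorings_def)
    then show ?thesis
      using inj_on_image_Int[OF \<phi>(1) used1 used1, of u v] by (simp add: c_def)
  next
    case False
    then have "(u, v) \<in> parcs G2" using uv G by blast
    then show ?thesis using wf2 c_2 c2 by (auto simp: multifold_colorings_def)
  qed
  moreover have "finite (c v) \<and> card (c v) = b" if "v \<in> pverts G" for v
  proof (cases "v \<in> pverts G1")
    case False
    then have "v \<in> pverts G2" using that G by blast
    then show ?thesis using c_2 c2 by (simp add: multifold_colorings_def)
  qed (simp add: c_1)
  moreover have "c v = {}" if "v \<notin> pverts G" for v
    using that G c2 by (simp add: c_def multifold_colorings_def)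
  ultimately have "(b, c) \<in> multifold_colorings G"
    using c1 by (auto simp: multifold_colorings_def)
  moreover have "c v \<subseteq> used_colors G2 c2" if "v \<in> pverts G" for v
  proof (cases "v \<in> pverts G1")
    case True
    then show ?thesis using \<phi>(2) used1[OF True] by (auto simp: c_def)
  next
    case False
    then show ?thesis using that G by (auto simp: c_def used_colors_def)
  qed
  then have "card (used_colors G c) \<le> card (used_colors G2 c2)"
    using finU(2) by (intro card_mono) (auto simp: used_colors_def[of G c])
  ultimately show ?thesis by (rule that)
qed

text \<open>Multiples bring both colorings to one fold number without changing weights, so equal
  restricted weights become equal numbers of colors. The coloring with more colors, whose ratio is
  still at most \<open>t\<close>, then supplies the colors for both.\<close>

lemma glue_frac_colorings:
  fixes G G1 G2 H :: "'a pair_pre_digraph"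
  assumes fin: "finite (pverts G)"
    and wf1: "\<And>u v. (u, v) \<in> parcs G1 \<Longrightarrow> u \<in> pverts G1 \<and> v \<in> pverts G1"
    and wf2: "\<And>u v. (u, v) \<in> parcs G2 \<Longrightarrow> u \<in> pverts G2 \<and> v \<in> pverts G2"
    and G: "pverts G = pverts G1 \<union> pverts G2" "parcs G = parcs G1 \<union> parcs G2"
    and H: "pverts H = pverts G1 \<inter> pverts G2"
    and w1: "w1 \<in> weightings_le G1 t" and w2: "w2 \<in> weightings_le G2 t"
    and agree: "restrict_weighting G1 H w1 = restrict_weighting G2 H w2"
  obtains f where "f \<in> frac_colorings G" and "color_ratio G f \<le> t"
proof -
  have fin1: "finite (pverts G1)" and fin2: "finite (pverts G2)" using fin G by auto
  have H1: "pverts H \<subseteq> pverts G1" and H2: "pverts H \<subseteq> pverts G2" using H by auto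
  have weightings: "w1 \<in> weightings G1" "w2 \<in> weightings G2"
    using w1 w2 by (auto simp: weightings_le_def)
  obtain x1 where x1: "x1 \<in> multifold_colorings G1" "class_weight G1 x1 = w1"
    using weighting_realizable[OF fin1 weightings(1)] .
  obtain x2 where x2: "x2 \<in> multifold_colorings G2" "class_weight G2 x2 = w2"
    using weighting_realizable[OF fin2 weightings(2)] .
  obtain b1 d1 b2 d2 where x: "x1 = (b1, d1)" "x2 = (b2, d2)" by (cases x1, cases x2)
  \<comment> \<open>The product of the fold numbers, reached by \<open>b2\<close> copies of
    \<open>d1\<close> and \<open>b1\<close> copies of \<open>d2\<close>.\<close>
  define b where "b = b1 * b2"
  define c1 where "c1 = coloring_mult b2 d1"
  define c2 where "c2 = coloring_mult b1 d2"
  have pos: "b1 > 0" "b2 > 0" using x1 x2 x by (auto simp: multifold_colorings_iff)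
  have c1: "(b, c1) \<in> multifold_colorings G1" "class_weight G1 (b, c1) = w1"
    using class_weight_mult[OF fin1, of b1 d1 b2] x1 x pos by (auto simp: b_def c1_def mult.commute)
  have c2: "(b, c2) \<in> multifold_colorings G2" "class_weight G2 (b, c2) = w2"
    using class_weight_mult[OF fin2, of b2 d2 b1] x2 x pos by (auto simp: b_def c2_def)
  have "class_weight H (b, c1) = class_weight H (b, c2)"
    using class_weight_restrict[OF fin1 H1 c1(1)] class_weight_restrict[OF fin2 H2 c2(1)]
      c1(2) c2(2) agree by simp
  then have size: "class_size H c1 = class_size H c2"
    using pos by (auto simp: class_weight_def fun_eq_iff b_def)
  have G': "pverts G = pverts G2 \<union> pverts G1" "parcs G = parcs G2 \<union> parcs G1"
    and H': "pverts H = pverts G2 \<inter> pverts G1" using G H by auto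
  have ratio: "of_nat (card (used_colors G1 c1)) / of_nat b \<le> t"
    "of_nat (card (used_colors G2 c2)) / of_nat b \<le> t"
    using total_class_weight[OF fin1 c1(1)] total_class_weight[OF fin2 c2(1)] c1(2) c2(2) w1 w2
    by (auto simp: weightings_le_def)
  obtain c where c: "(b, c) \<in> multifold_colorings G"
    "of_nat (card (used_colors G c)) / of_nat b \<le> t"
  proof (cases "card (used_colors G1 c1) \<le> card (used_colors G2 c2)")
    case True
    obtain c where c: "(b, c) \<in> multifold_colorings G"
      "card (used_colors G c) \<le> card (used_colors G2 c2)"
      using glue_colorings[OF fin wf1 wf2 G H c1(1) c2(1) size True] .
    from c(2) have "of_nat (card (used_colors G c)) / of_nat b \<le>
        (of_nat (card (used_colors G2 c2)) / of_nat b :: rat)" by (simp add: divide_right_mono)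
    then show ?thesis using that c(1) ratio(2) by (meson order_trans)
  next
    case False
    \<comment> \<open>The situation is symmetric, so the two parts exchange roles.\<close>
    then have False': "card (used_colors G2 c2) \<le> card (used_colors G1 c1)" by simp
    obtain c where c: "(b, c) \<in> multifold_colorings G"
      "card (used_colors G c) \<le> card (used_colors G1 c1)"
      using glue_colorings[OF fin wf2 wf1 G' H' c2(1) c1(1) size[symmetric] False'] .
    from c(2) have "of_nat (card (used_colors G c)) / of_nat b \<le>
        (of_nat (card (used_colors G1 c1)) / of_nat b :: rat)" by (simp add: divide_right_mono)
    then show ?thesis using that c(1) ratio(1) by (meson order_trans)
  qed
  have "total_weight G (class_weight G (b, c)) \<le> t"
    using total_class_weight[OF fin c(1)] c(2) by simp
  moreover obtain f where f: "f \<in> frac_colorings G" "weighting_of G f = class_weight G (b, c)"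
    using weighting_of_surj[OF fin class_weight_in_weightings[OF fin c(1)]] .
  ultimately show ?thesis using that color_ratio_eq[OF fin f(1)] by simp
qed

theorem theorem3:
  fixes G G1 G2 H :: "'a pair_pre_digraph" and t :: rat
  assumes "pair_graph G" and "pair_graph G1" and "pair_graph G2"
    and "subgraph (with_proj G1) (with_proj G)" and "subgraph (with_proj G2) (with_proj G)"
    and "pverts G = pverts G1 \<union> pverts G2" and "parcs G = parcs G1 \<union> parcs G2"
    and "pverts H = pverts G1 \<inter> pverts G2" and "parcs H = parcs G1 \<inter> parcs G2"
    and "frac_chromatic_number G1 \<le> t"
    and "\<And>f. extremal H t f \<Longrightarrow> extensible H G2 t f"
  shows "frac_chromatic_number G \<le> t"
proof -
  interpret G: pair_graph G by fact
  interpret G1: pair_graph G1 by fact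
  interpret G2: pair_graph G2 by fact
  have fin: "finite (pverts G)" "finite (pverts G1)" "finite (pverts G2)" "finite (pverts H)"
    using G.pair_finite_verts G1.pair_finite_verts G2.pair_finite_verts assms(8) by auto
  have wf1: "u \<in> pverts G1 \<and> v \<in> pverts G1" if "(u, v) \<in> parcs G1" for u v
    using that G1.in_arcsD1 G1.in_arcsD2 by blast
  have wf2: "u \<in> pverts G2 \<and> v \<in> pverts G2" if "(u, v) \<in> parcs G2" for u v
    using that G2.in_arcsD1 G2.in_arcsD2 by blast
  have wfH: "u \<in> pverts H \<and> v \<in> pverts H" if "(u, v) \<in> parcs H" for u v
    using that wf1 wf2 assms(8,9) by auto
  have H1: "pverts H \<subseteq> pverts G1" "parcs H \<subseteq> parcs G1"
    and H2: "pverts H \<subseteq> pverts G2" "parcs H \<subseteq> parcs G2" using assms(8,9) by auto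
  have loop1: "(v, v) \<notin> parcs G1" for v using G1.pair_no_loops[of "(v, v)"] by auto

  \<comment> \<open>The set of weightings of \<open>H\<close> that extend is closed under convex
    combinations, because \<open>weightings_le G2 t\<close> is convex and restriction is linear.
    Thus only vertices are left to the hypothesis on extremal colorings.\<close>
  have extends: "\<exists>w'\<in>weightings_le G2 t. restrict_weighting G2 H w' = w"
    if w: "w \<in> weightings_le H t" for w
    using fin(4) w
  proof (rule vertex_induct)
    fix w assume v: "vertex H t w"
    then have le: "w \<in> weightings_le H t" by (simp add: vertex_def)
    then obtain f where f: "f \<in> frac_colorings H" "weighting_of H f = w"
      using weighting_of_surj[OF fin(4)] by (auto simp: weightings_le_def)
    have "f \<in> frac_colorings_le H t" using frac_colorings_le_iff[OF fin(4) f(1)] le f(2) by simp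
    then have "extremal H t f" using extremal_if_vertex[OF fin(4)] v f(2) by simp
    then obtain f' where f': "f' \<in> frac_colorings_le G2 t" "f = frac_restrict H f'"
      using assms(11) by (auto simp: extensible_def)
    then have f'G: "f' \<in> frac_colorings G2" by (simp add: frac_colorings_le_def)
    have "restrict_weighting G2 H (weighting_of G2 f') = w"
      using frac_restrict(2)[OF fin(3) H2 wfH f'G] f'(2) f(2) by simp
    moreover have "weighting_of G2 f' \<in> weightings_le G2 t"
      using frac_colorings_le_iff[OF fin(3) f'G] f'(1) by simp
    ultimately show "\<exists>w'\<in>weightings_le G2 t. restrict_weighting G2 H w' = w" by blast
  next
    fix w1 w2 and l :: rat
    assume "\<exists>w'\<in>weightings_le G2 t. restrict_weighting G2 H w' = w1"
      "\<exists>w'\<in>weightings_le G2 t. restrict_weighting G2 H w' = w2" and l: "0 < l" "l < 1"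
    then obtain v1 v2 where v: "v1 \<in> weightings_le G2 t" "v2 \<in> weightings_le G2 t"
      "restrict_weighting G2 H v1 = w1" "restrict_weighting G2 H v2 = w2" by blast
    have "(\<lambda>S. l * v1 S + (1 - l) * v2 S) \<in> weightings_le G2 t"
      using weightings_le_convex[OF v(1,2)] l by simp
    moreover have "restrict_weighting G2 H (\<lambda>S. l * v1 S + (1 - l) * v2 S) =
        (\<lambda>S. l * w1 S + (1 - l) * w2 S)"
      by (simp add: restrict_weighting_combination v(3,4))
    ultimately show "\<exists>w'\<in>weightings_le G2 t.
        restrict_weighting G2 H w' = (\<lambda>S. l * w1 S + (1 - l) * w2 S)" by blast
  qed

  \<comment> \<open>The bound on \<open>frac_chromatic_number G1\<close> yields an actual fractional
    coloring only because the minimum is attained.\<close>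
  obtain f0 where "f0 \<in> frac_colorings G1" using frac_colorings_nonempty[OF fin(2) loop1] .
  then obtain f1 where f1: "f1 \<in> frac_colorings G1" "color_ratio G1 f1 = frac_chromatic_number G1"
    using frac_chromatic_number_attained[OF fin(2)] by metis
  let ?w1 = "weighting_of G1 f1"
  have w1: "?w1 \<in> weightings_le G1 t"
    using frac_colorings_le_iff[OF fin(2) f1(1), of t] f1 assms(10)
    by (simp add: frac_colorings_le_def)
  have "restrict_weighting G1 H ?w1 \<in> weightings_le H t"
    using frac_restrict[OF fin(2) H1 wfH f1(1)] weighting_of_in_weightings[OF fin(4)] w1
    by (force simp: weightings_le_def)
  then obtain w2 where w2: "w2 \<in> weightings_le G2 t"
    "restrict_weighting G1 H ?w1 = restrict_weighting G2 H w2"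
    using extends by metis
  obtain f where f: "f \<in> frac_colorings G" "color_ratio G f \<le> t"
    using glue_frac_colorings[OF fin(1) wf1 wf2 assms(6-8) w1 w2] .
  then show ?thesis
    using frac_chromatic_number_attained[OF fin(1) f(1)] by (meson order_trans)
qed

end
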